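(* Let $n$ be a nonzero integer and let $K=J(2,2n)$ be the twist knot, with knot group $G_K=\langle a,b\mid w^na=bw^n\rangle$, $w=ba^{-1}b^{-1}a$. Suppose $\rho:G_K\to SL_2(\mathbb{C})$ is a nonabelian representation, and let $x=\mathrm{tr}\,\rho(a)=\mathrm{tr}\,\rho(b)$ and $y=\mathrm{tr}\,\rho(ab^{-1})$. Then $$\Delta^{\mathrm{Ad}\circ\rho}_{K}(t)=\frac{t-1}{(y+2-x^2)(y^2-yx^2+x^2)}\left(nt^2+\frac{(2n-1)y^2+yx^2-2nx^2(x^2-2)}{y^2-yx^2+2x^2}\,t+n\right).$$
   Context: Twisted Alexander polynomial. Let $K$ be a knot in $S^3$ and let $G_K=\pi_1(S^3\setminus K)=\langle a_1,\dots,a_\ell\mid r_1,\dots,r_{\ell-1}\rangle$ be a deficiency-one presentation. Let $f:G_K\to H_1(S^3\setminus K;\mathbb{Z})\cong\mathbb{Z}=\langle t\rangle$ be the abelianization and $\sigma:G_K\to SL_N(\mathbb{C})$ a representation. Let $\Phi:\mathbb{Z}[F_\ell]\to M_N(\mathbb{C}[t^{\pm1}])$ be the ring homomorphism from the group ring of the free group $F_\ell$ on $a_1,\dots,a_\ell$ determined by $g\mapsto f(g)\,\sigma(g)$ for $g\in F_\ell$ (where $g$ is first mapped to $G_K$). Let $M$ be the $(\ell-1)\times\ell$ block matrix whose $(i,j)$ block is $\Phi(\partial r_i/\partial a_j)$, where $\partial/\partial a_j$ is the Fox derivative, and let $M_j$ be $M$ with its $j$-th block column removed, regarded as an $N(\ell-1)\times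 N(\ell-1)$ matrix. Wada's twisted Alexander polynomial is the rational function $$\Delta_K^{\sigma}(t)=\frac{\det M_j}{\det\Phi(1-a_j)},$$ defined up to a factor $t^{Nm}$, $m\in\mathbb{Z}$; equalities between twisted Alexander polynomials and explicit functions are understood with this convention. Adjoint action. For $A\in SL_2(\mathbb{C})$ and $g\in sl_2(\mathbb{C})$, $\mathrm{Ad}_A(g)=AgA^{-1}$. For $\rho:G_K\to SL_2(\mathbb{C})$, the composition $\mathrm{Ad}\circ\rho$ is a representation $G_K\to SL_3(\mathbb{C})$ (after choosing a basis of $sl_2(\mathbb{C})\cong\mathbb{C}^3$), and $\Delta_K^{\mathrm{Ad}\circ\rho}(t)$ is its twisted Alexander polynomial (so $N=3$). Twist knots. $J(k,l)$ is the two-bridge link formed by two twist regions with $k$ and $l$ half twists (positive numbers meaning right-handed twists, negative numbers left-handed twists); $J(2,2n)$ is the twist knot. Its knot group has the presentation $\langle a,b\mid w^na=bw^n\rangle$ with $w=ba^{-1}b^{-1}a$, where $a,b$ are meridians. A representation $\rho:G_K\to SL_2(\mathbb{C})$ is nonabelian if $\rho(G_K)$ is a nonabelian subgroup of $SL_2(\mathbb{C})$.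
   Formalization: The case y²−yx²+2x²=0, where the displayed fraction is 0/0, is excluded; the meridian a is sent to t, the relator is wⁿa(bwⁿ)⁻¹, and the formula holds as displayed when the block column of a is removed and with the opposite sign when that of b is removed. *)

theory Defs
  imports
    "Jordan_Normal_Form.Determinant"
    "HOL-Algebra.Generated_Groups"
    "HOL-Algebra.Elementary_Groups"
    "HOL-Library.Poly_Mapping"
begin

section \<open>Free groups\<close>

text \<open>
  A letter \<open>(x, True)\<close> stands for the generator \<open>x\<close> and \<open>(x, False)\<close> for its inverse.
\<close>

inductive free_eq :: "('a \<times> bool) list \<Rightarrow> ('a \<times> bool) list \<Rightarrow> bool" where
  cancel: "free_eq (u @ [(x, s), (x, \<not> s)] @ v) (u @ v)"
| refl: "free_eq u u"
| sym: "free_eq u v \<Longrightarrow> free_eq v u"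
| trans: "free_eq u v \<Longrightarrow> free_eq v w \<Longrightarrow> free_eq u w"

quotient_type 'a free_group = "('a \<times> bool) list" / free_eq
  by (auto intro!: equivpI reflpI sympI transpI intro: free_eq.intros)

lemma free_eq_context: "free_eq u v \<Longrightarrow> free_eq (p @ u @ q) (p @ v @ q)"
proof (induction rule: free_eq.induct)
  case (cancel u x s v)
  show ?case using free_eq.cancel[of "p @ u" x s "v @ q"] by simp
qed (auto intro: free_eq.intros)

lemma free_eq_append: "free_eq u u' \<Longrightarrow> free_eq v v' \<Longrightarrow> free_eq (u @ v) (u' @ v')"
  using free_eq_context[of u u' "[]" v] free_eq_context[of v v' u' "[]"]
  by (auto intro: free_eq.trans)

definition inv_word :: "('a \<times> bool) list \<Rightarrow> ('a \<times> bool) list" where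
  "inv_word u = rev (map (\<lambda>(x, s). (x, \<not> s)) u)"

lemma free_eq_inv_word: "free_eq u v \<Longrightarrow> free_eq (inv_word u) (inv_word v)"
proof (induction rule: free_eq.induct)
  case (cancel u x s v)
  show ?case using free_eq.cancel[of "inv_word v" x s "inv_word u"] by (simp add: inv_word_def)
qed (auto intro: free_eq.intros)

lemma free_eq_inv_word_append: "free_eq (inv_word u @ u) []"
proof (induction u)
  case Nil
  show ?case by (simp add: inv_word_def free_eq.refl)
next
  case (Cons p u)
  obtain x s where p: "p = (x, s)" by (cases p)
  have "free_eq (inv_word u @ [(x, \<not> s), (x, \<not> \<not> s)] @ u) (inv_word u @ u)"
    by (rule free_eq.cancel)
  then show ?case using Cons.IH by (auto simp: p inv_word_def intro: free_eq.trans)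
qed

text \<open>
  The free group is written additively, so that the library's monoid algebra
  \<^typ>\<open>'a free_group \<Rightarrow>\<^sub>0 int\<close> is its integral group ring.
\<close>

instantiation free_group :: (type) group_add
begin

lift_definition zero_free_group :: "'a free_group" is "[]" .
lift_definition plus_free_group :: "'a free_group \<Rightarrow> 'a free_group \<Rightarrow> 'a free_group" is "(@)"
  by (rule free_eq_append)
lift_definition uminus_free_group :: "'a free_group \<Rightarrow> 'a free_group" is inv_word
  by (rule free_eq_inv_word)
definition minus_free_group :: "'a free_group \<Rightarrow> 'a free_group \<Rightarrow> 'a free_group" where
  "minus_free_group g h = g + - h"

instance
proof
  fix a b c :: "'a free_group"
  show "a + b + c = a + (b + c)" by transfer (simp add: free_eq.refl)
  show "0 + a = a" by transfer (simp add: free_eq.refl)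
  show "a + 0 = a" by transfer (simp add: free_eq.refl)
  show "- a + a = 0" by transfer (rule free_eq_inv_word_append)
  show "a + - b = a - b" by (simp add: minus_free_group_def)
qed

end

lift_definition gen :: "'a \<Rightarrow> 'a free_group" is "\<lambda>x. [(x, True)]" .

text \<open>\<open>free_grp l\<close> is the free group of rank \<open>l\<close>, with free generators \<open>gen 0, \<dots>, gen (l - 1)\<close>.\<close>

definition free_grp :: "nat \<Rightarrow> nat free_group monoid" where
  "free_grp l = subgroup_generated \<lparr>carrier = UNIV, mult = (+), one = 0\<rparr> (gen ` {..<l})"

lemma group_free_grp: "group (free_grp l)"
proof -
  have "group \<lparr>carrier = UNIV, mult = (+), one = 0 :: nat free_group\<rparr>"
    by (rule groupI) (auto simp: add.assoc intro: left_minus)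
  then show ?thesis unfolding free_grp_def by (rule group.group_subgroup_generated)
qed


section \<open>Fox calculus\<close>

type_synonym 'a group_ring = "'a free_group \<Rightarrow>\<^sub>0 int"

abbreviation elt :: "'a free_group \<Rightarrow> 'a group_ring" where
  "elt g \<equiv> Poly_Mapping.single g 1"

primrec fox_word :: "'a \<Rightarrow> ('a \<times> bool) list \<Rightarrow> 'a group_ring" where
  "fox_word j [] = 0"
| "fox_word j (p # u) =
     (if fst p = j then (if snd p then 1 else - elt (- gen j)) else 0)
     + elt (if snd p then gen (fst p) else - gen (fst p)) * fox_word j u"

lemma abs_free_group_Cons:
  "abs_free_group (p # u) = (if snd p then gen (fst p) else - gen (fst p)) + abs_free_group u"
  by (cases p) (auto simp: gen.abs_eq uminus_free_group.abs_eq plus_free_group.abs_eq inv_word_def)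

lemma abs_free_group_Nil: "abs_free_group [] = 0"
  by (simp add: zero_free_group_def)

lemma fox_word_append:
  "fox_word j (u @ v) = fox_word j u + elt (abs_free_group u) * fox_word j v"
proof (induction u)
  case Nil
  show ?case by (simp add: abs_free_group_Nil)
next
  case (Cons p u)
  then show ?case
    by (simp only: append_Cons fox_word.simps abs_free_group_Cons distrib_left add.assoc
        mult_single mult_1 flip: mult.assoc)
qed

lemma fox_word_cong: "free_eq u v \<Longrightarrow> fox_word j u = fox_word j v"
proof (induction rule: free_eq.induct)
  case (cancel u x s v)
  have "abs_free_group ([(x, s), (x, \<not> s)]) = 0"
    by (simp add: abs_free_group_Cons abs_free_group_Nil)
  moreover have "fox_word j [(x, s), (x, \<not> s)] = 0"
    by (simp add: mult_single)
  ultimately show ?case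
    unfolding fox_word_append by simp
qed auto

lift_definition fox :: "'a \<Rightarrow> 'a free_group \<Rightarrow> 'a group_ring" is fox_word
  by (rule fox_word_cong)

text \<open>The defining properties of the Fox derivative.\<close>

lemma fox_gen: "fox j (gen i) = (if i = j then 1 else 0)"
  by transfer simp

lemma fox_mult: "fox j (g + h) = fox j g + elt g * fox j h"
proof -
  obtain u v where gh: "g = abs_free_group u" "h = abs_free_group v"
    by (metis Quotient3_abs_rep Quotient3_free_group)
  show ?thesis
    by (simp only: gh plus_free_group.abs_eq fox.abs_eq fox_word_append)
qed


section \<open>Finitely presented groups\<close>

definition normal_closure :: "('a, 'b) monoid_scheme \<Rightarrow> 'a set \<Rightarrow> 'a set" where
  "normal_closure G R = \<Inter>{N. N \<lhd> G \<and> R \<subseteq> N}"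

definition presented_group :: "nat \<Rightarrow> nat free_group list \<Rightarrow> nat free_group set monoid" where
  "presented_group l rs = free_grp l Mod normal_closure (free_grp l) (set rs)"

definition pres_class :: "nat \<Rightarrow> nat free_group list \<Rightarrow> nat free_group \<Rightarrow> nat free_group set" where
  "pres_class l rs g = normal_closure (free_grp l) (set rs) #>\<^bsub>free_grp l\<^esub> g"

definition is_abelianization :: "('a, 'b) monoid_scheme \<Rightarrow> ('a \<Rightarrow> int) \<Rightarrow> bool" where
  "is_abelianization G f \<longleftrightarrow>
     f \<in> hom G integer_group \<and> f ` carrier G = UNIV \<and>
     kernel G integer_group f = derived G (carrier G)"


section \<open>The twisted Alexander polynomial\<close>

text \<open>
  Laurent polynomials and rational functions in \<open>t\<close> are both taken in the field of rational
  functions over the complex numbers.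
\<close>

type_synonym ratfun = "complex poly fract"

definition tvar :: ratfun where "tvar = to_fract [:0, 1:]"
definition cst :: "complex \<Rightarrow> ratfun" where "cst c = to_fract [:c:]"

text \<open>
  \<open>Phi l rs N f \<sigma>\<close> is the linear extension of \<open>g \<mapsto> t\<^bsup>f(g)\<^esup> \<sigma>(g)\<close> to the group ring,
  where \<open>f\<close> and \<open>\<sigma>\<close> are maps on the presented group.
\<close>

definition Phi :: "nat \<Rightarrow> nat free_group list \<Rightarrow> nat \<Rightarrow> (nat free_group set \<Rightarrow> int)
    \<Rightarrow> (nat free_group set \<Rightarrow> complex mat) \<Rightarrow> nat group_ring \<Rightarrow> ratfun mat" where
  "Phi l rs N f \<sigma> z = mat N N (\<lambda>(p, q). \<Sum>g\<in>Poly_Mapping.keys z.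
     of_int (Poly_Mapping.lookup z g) * tvar powi f (pres_class l rs g)
       * cst (\<sigma> (pres_class l rs g) $$ (p, q)))"

definition fox_matrix :: "nat \<Rightarrow> nat free_group list \<Rightarrow> nat \<Rightarrow> (nat free_group set \<Rightarrow> int)
    \<Rightarrow> (nat free_group set \<Rightarrow> complex mat) \<Rightarrow> ratfun mat" where
  "fox_matrix l rs N f \<sigma> = mat (N * (l - 1)) (N * l)
     (\<lambda>(p, q). Phi l rs N f \<sigma> (fox (q div N) (rs ! (p div N))) $$ (p mod N, q mod N))"

text \<open>Removal of the \<open>j\<close>-th block column; block columns are numbered from 0.\<close>

definition fox_matrix_delete :: "nat \<Rightarrow> nat free_group list \<Rightarrow> nat \<Rightarrow> (nat free_group set \<Rightarrow> int)
    \<Rightarrow> (nat free_group set \<Rightarrow> complex mat) \<Rightarrow> nat \<Rightarrow> ratfun mat" where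
  "fox_matrix_delete l rs N f \<sigma> j = mat (N * (l - 1)) (N * (l - 1))
     (\<lambda>(p, q). fox_matrix l rs N f \<sigma> $$ (p, N * insert_index j (q div N) + q mod N))"

definition twisted_alexander :: "nat \<Rightarrow> nat free_group list \<Rightarrow> nat \<Rightarrow> (nat free_group set \<Rightarrow> int)
    \<Rightarrow> (nat free_group set \<Rightarrow> complex mat) \<Rightarrow> nat \<Rightarrow> ratfun" where
  "twisted_alexander l rs N f \<sigma> j =
     det (fox_matrix_delete l rs N f \<sigma> j) / det (Phi l rs N f \<sigma> (1 - elt (gen j)))"

text \<open>
  Equality up to a factor \<open>t\<^bsup>Nm\<^esup>\<close>. For odd \<open>N\<close> the quotient above still depends up to sign
  on the block column removed and on whether a relator or its inverse is used.
\<close>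

definition eq_upto_unit :: "nat \<Rightarrow> ratfun \<Rightarrow> ratfun \<Rightarrow> bool" where
  "eq_upto_unit N P Q \<longleftrightarrow> (\<exists>m::int. P = tvar powi (int N * m) * Q)"


section \<open>The adjoint action\<close>

definition SL :: "nat \<Rightarrow> complex mat monoid" where
  "SL n = \<lparr>carrier = {A \<in> carrier_mat n n. det A = 1}, mult = (*), one = 1\<^sub>m n\<rparr>"

lemma group_SL: "group (SL n)"
proof (rule groupI)
  fix A assume "A \<in> carrier (SL n)"
  then have A: "A \<in> carrier_mat n n" "det A = 1" by (auto simp: SL_def)
  have adj: "adj_mat A \<in> carrier_mat n n" "A * adj_mat A = 1\<^sub>m n" "adj_mat A * A = 1\<^sub>m n"
    using adj_mat[OF A(1)] A(2) by auto
  have "det (adj_mat A) = 1"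
    using det_mult[OF adj(1) A(1)] adj(3) A(2) by simp
  with adj show "\<exists>C\<in>carrier (SL n). C \<otimes>\<^bsub>SL n\<^esub> A = \<one>\<^bsub>SL n\<^esub>"
    by (auto simp: SL_def)
qed (auto simp: SL_def det_mult)

definition mat_trace :: "'a::comm_monoid_add mat \<Rightarrow> 'a" where
  "mat_trace A = (\<Sum>i<dim_row A. A $$ (i, i))"

definition sl2 :: "complex mat set" where
  "sl2 = {X \<in> carrier_mat 2 2. mat_trace X = 0}"

definition Ad :: "complex mat \<Rightarrow> complex mat \<Rightarrow> complex mat" where
  "Ad A X = A * X * inv\<^bsub>SL 2\<^esub> A"

definition lin_comb3 :: "(nat \<Rightarrow> complex mat) \<Rightarrow> complex vec \<Rightarrow> complex mat" where
  "lin_comb3 B c = c $ 0 \<cdot>\<^sub>m B 0 + c $ 1 \<cdot>\<^sub>m B 1 + c $ 2 \<cdot>\<^sub>m B 2"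

definition sl2_basis :: "(nat \<Rightarrow> complex mat) \<Rightarrow> bool" where
  "sl2_basis B \<longleftrightarrow> (\<forall>i<3. B i \<in> sl2) \<and> bij_betw (lin_comb3 B) (carrier_vec 3) sl2"

definition coords :: "(nat \<Rightarrow> complex mat) \<Rightarrow> complex mat \<Rightarrow> complex vec" where
  "coords B = inv_into (carrier_vec 3) (lin_comb3 B)"

definition Ad_mat :: "(nat \<Rightarrow> complex mat) \<Rightarrow> complex mat \<Rightarrow> complex mat" where
  "Ad_mat B A = mat_of_cols 3 (map (\<lambda>j. coords B (Ad A (B j))) [0..<3])"


section \<open>Twist knot groups\<close>

text \<open>The generators \<open>a\<close> and \<open>b\<close> are \<open>gen 0\<close> and \<open>gen 1\<close>.\<close>

definition twist_w :: "nat free_group" where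
  "twist_w = gen 1 \<otimes>\<^bsub>free_grp 2\<^esub> inv\<^bsub>free_grp 2\<^esub> gen 0 \<otimes>\<^bsub>free_grp 2\<^esub> inv\<^bsub>free_grp 2\<^esub> gen 1 \<otimes>\<^bsub>free_grp 2\<^esub> gen 0"

text \<open>The relation \<open>w\<^sup>n a = b w\<^sup>n\<close> is read as the relator \<open>w\<^sup>n a (b w\<^sup>n)\<^sup>-\<^sup>1\<close>.\<close>

definition twist_relator :: "int \<Rightarrow> nat free_group" where
  "twist_relator n = (twist_w [^]\<^bsub>free_grp 2\<^esub> n \<otimes>\<^bsub>free_grp 2\<^esub> gen 0)
     \<otimes>\<^bsub>free_grp 2\<^esub> inv\<^bsub>free_grp 2\<^esub> (gen 1 \<otimes>\<^bsub>free_grp 2\<^esub> twist_w [^]\<^bsub>free_grp 2\<^esub> n)"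

definition twist_group :: "int \<Rightarrow> nat free_group set monoid" where
  "twist_group n = presented_group 2 [twist_relator n]"

definition mer_a :: "int \<Rightarrow> nat free_group set" where
  "mer_a n = pres_class 2 [twist_relator n] (gen 0)"

definition mer_b :: "int \<Rightarrow> nat free_group set" where
  "mer_b n = pres_class 2 [twist_relator n] (gen 1)"

text \<open>
  The twisted Alexander polynomial of the twist knot computed by removing block column \<open>j\<close>
  (0 for \<open>a\<close>, 1 for \<open>b\<close>).
\<close>

definition twist_alexander :: "int \<Rightarrow> nat \<Rightarrow> (nat free_group set \<Rightarrow> int)
    \<Rightarrow> (nat free_group set \<Rightarrow> complex mat) \<Rightarrow> nat \<Rightarrow> ratfun" where
  "twist_alexander n = twisted_alexander 2 [twist_relator n]"

end

theory Submission
  imports Defs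
begin

text \<open>
  A nonabelian representation is conjugate to \<open>a \<mapsto> A = (m, m\<^sup>-\<^sup>1; 0, m\<^sup>-\<^sup>1)\<close>,
  \<open>b \<mapsto> B = (m, 0; q m, m\<^sup>-\<^sup>1)\<close>, and then \<open>y = 2 - q\<close>. Put \<open>W = \<rho>(w)\<close>, \<open>z = tr W\<close> and let
  \<open>\<alpha>, \<beta>, \<gamma>\<close> be the adjoint images of \<open>a\<close>, \<open>b\<close>, \<open>b a\<^sup>-\<^sup>1 b\<^sup>-\<^sup>1\<close>. By Fox calculus the Fox derivative of the
  relator with respect to \<open>b\<close> goes to \<open>(1 - t \<beta>) \<Sigma> (1 - t\<^sup>-\<^sup>1 \<gamma>) - 1\<close>, where \<open>\<Sigma> = \<Sum>i<n. Ad(W\<^sup>i)\<close>.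

  Write \<open>W\<^sup>n = S W - S'\<close>. The relation says \<open>S' = k S\<close> with \<open>k = x\<^sup>2 - 1 - y\<close>, and \<open>det W\<^sup>n = 1\<close> then
  gives \<open>S\<^sup>2 (1 + k\<^sup>2 - z k) = 1\<close>, where \<open>1 + k\<^sup>2 - z k = (y + 2 - x\<^sup>2)(y\<^sup>2 - y x\<^sup>2 + x\<^sup>2)\<close>. The operator
  \<open>\<kappa> = [W, -]\<close> satisfies \<open>\<kappa>\<^sup>3 = (z\<^sup>2 - 4) \<kappa>\<close>, and \<open>\<Sigma> = n + p \<kappa> + r \<kappa>\<^sup>2\<close> with \<open>p = S S' / 2\<close>
  and \<open>n + r (z\<^sup>2 - 4) = S\<^sup>2 - z S S' / 2\<close>; its determinant is \<open>n S\<^sup>2\<close>. As \<open>z\<^sup>2 - 4 - \<kappa>\<^sup>2\<close> has rank at most one,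
  \<open>\<Sigma>\<^sup>-\<^sup>1\<close> is a polynomial matrix in \<open>m\<^sup>\<plusminus>\<^sup>1\<close> and \<open>q\<close> up to a rank-one term, so that
  \<open>det(\<alpha> \<beta>\<^sup>-\<^sup>1 ((1 - t\<^sup>-\<^sup>1 \<gamma>)(1 - t \<beta>) - \<Sigma>\<^sup>-\<^sup>1))\<close> reduces to two polynomial identities.
  The coefficient \<open>r\<close> enters only through \<open>(z - 2) r\<close>, so the case \<open>z = 2\<close> needs no special treatment, and
  \<open>z + 2\<close> is the denominator \<open>y\<^sup>2 - y x\<^sup>2 + 2 x\<^sup>2\<close>.
\<close>

section \<open>Matrices of size 2 and 3\<close>

text \<open>Named entries turn matrix identities into finitely many scalar identities, which can
  then be settled by Groebner bases.\<close>

definition mat2 :: "'a \<Rightarrow> 'a \<Rightarrow> 'a \<Rightarrow> 'a \<Rightarrow> 'a mat" where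
  "mat2 a b c d = mat_of_rows_list 2 [[a, b], [c, d]]"

definition mat3 ::
  "'a \<Rightarrow> 'a \<Rightarrow> 'a \<Rightarrow> 'a \<Rightarrow> 'a \<Rightarrow> 'a \<Rightarrow> 'a \<Rightarrow> 'a \<Rightarrow> 'a \<Rightarrow> 'a mat" where
  "mat3 a b c d e f g h i = mat_of_rows_list 3 [[a, b, c], [d, e, f], [g, h, i]]"

lemma mat2_carrier [simp]: "mat2 a b c d \<in> carrier_mat 2 2"
  by (simp add: mat2_def mat_of_rows_list_def numeral_2_eq_2)

lemma mat3_carrier [simp]: "mat3 a b c d e f g h i \<in> carrier_mat 3 3"
  by (simp add: mat3_def mat_of_rows_list_def numeral_3_eq_3)

lemma mat2_dim [simp]: "dim_row (mat2 a b c d) = 2" "dim_col (mat2 a b c d) = 2"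
  by (simp_all add: mat2_def mat_of_rows_list_def)

lemma mat3_dim [simp]: "dim_row (mat3 a b c d e f g h i) = 3" "dim_col (mat3 a b c d e f g h i) = 3"
  by (simp_all add: mat3_def mat_of_rows_list_def)

lemma mat2_index [simp]:
  "mat2 a b c d $$ (0, 0) = a" "mat2 a b c d $$ (0, Suc 0) = b"
  "mat2 a b c d $$ (Suc 0, 0) = c" "mat2 a b c d $$ (Suc 0, Suc 0) = d"
  by (simp_all add: mat2_def mat_of_rows_list_def)

lemma mat3_index [simp]:
  "mat3 a b c d e f g h i $$ (0, 0) = a" "mat3 a b c d e f g h i $$ (0, Suc 0) = b"
  "mat3 a b c d e f g h i $$ (0, 2) = c" "mat3 a b c d e f g h i $$ (Suc 0, 0) = d"
  "mat3 a b c d e f g h i $$ (Suc 0, Suc 0) = e" "mat3 a b c d e f g h i $$ (Suc 0, 2) = f"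
  "mat3 a b c d e f g h i $$ (2, 0) = g" "mat3 a b c d e f g h i $$ (2, Suc 0) = h"
  "mat3 a b c d e f g h i $$ (2, 2) = i"
  by (simp_all add: mat3_def mat_of_rows_list_def numeral_2_eq_2)

lemma all_less_2: "(\<forall>i<2. P i) \<longleftrightarrow> P 0 \<and> P (Suc 0)"
  by (auto simp: numeral_2_eq_2 less_Suc_eq)

lemma all_less_3: "(\<forall>i<3. P i) \<longleftrightarrow> P 0 \<and> P (Suc 0) \<and> P 2"
  by (auto simp: numeral_3_eq_3 numeral_2_eq_2 less_Suc_eq)

lemma mat2_eqI:
  assumes "M \<in> carrier_mat 2 2"
    and "M $$ (0, 0) = a" "M $$ (0, Suc 0) = b" "M $$ (Suc 0, 0) = c" "M $$ (Suc 0, Suc 0) = d"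
  shows "M = mat2 a b c d"
proof (rule eq_matI)
  have "\<forall>i<2. \<forall>j<2. M $$ (i, j) = mat2 a b c d $$ (i, j)"
    by (simp only: all_less_2 mat2_index assms simp_thms)
  then show "\<And>i j. i < dim_row (mat2 a b c d) \<Longrightarrow> j < dim_col (mat2 a b c d) \<Longrightarrow>
      M $$ (i, j) = mat2 a b c d $$ (i, j)"
    by simp
qed (use assms in auto)

lemma mat3_eqI:
  assumes "M \<in> carrier_mat 3 3"
    and "M $$ (0, 0) = a" "M $$ (0, Suc 0) = b" "M $$ (0, 2) = c"
    and "M $$ (Suc 0, 0) = d" "M $$ (Suc 0, Suc 0) = e" "M $$ (Suc 0, 2) = f"
    and "M $$ (2, 0) = g" "M $$ (2, Suc 0) = h" "M $$ (2, 2) = i"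
  shows "M = mat3 a b c d e f g h i"
proof (rule eq_matI)
  have "\<forall>j<3. \<forall>k<3. M $$ (j, k) = mat3 a b c d e f g h i $$ (j, k)"
    by (simp only: all_less_3 mat3_index assms simp_thms)
  then show "\<And>j k. j < dim_row (mat3 a b c d e f g h i) \<Longrightarrow> k < dim_col (mat3 a b c d e f g h i) \<Longrightarrow>
      M $$ (j, k) = mat3 a b c d e f g h i $$ (j, k)"
    by simp
qed (use assms in auto)

lemma mat2_cases:
  assumes "M \<in> carrier_mat 2 2"
  obtains a b c d where "M = mat2 a b c d"
  using mat2_eqI[OF assms] by blast

lemma mat2_eq_iff [simp]: "mat2 a b c d = mat2 a' b' c' d' \<longleftrightarrow> a = a' \<and> b = b' \<and> c = c' \<and> d = d'"
  by (metis mat2_index)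

lemma mat3_eq_iff [simp]:
  "mat3 a b c d e f g h i = mat3 a' b' c' d' e' f' g' h' i' \<longleftrightarrow>
    a = a' \<and> b = b' \<and> c = c' \<and> d = d' \<and> e = e' \<and> f = f' \<and> g = g' \<and> h = h' \<and> i = i'"
  by (metis mat3_index)

lemma mat2_one: "(1\<^sub>m 2 :: 'a::semiring_1 mat) = mat2 1 0 0 1"
  by (rule mat2_eqI) auto

lemma mat3_one: "(1\<^sub>m 3 :: 'a::semiring_1 mat) = mat3 1 0 0 0 1 0 0 0 1"
  by (rule mat3_eqI) auto

lemma sum_upto_2_3:
  "sum f {0..<2} = f 0 + f (Suc 0)" "sum f {0..<3} = f 0 + f (Suc 0) + f 2"
  by (simp_all add: numeral_3_eq_3 numeral_2_eq_2)

lemma mat2_arith: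
  fixes a b c d :: "'a::comm_ring_1"
  shows "mat2 a b c d + mat2 a' b' c' d' = mat2 (a + a') (b + b') (c + c') (d + d')"
    and "mat2 a b c d - mat2 a' b' c' d' = mat2 (a - a') (b - b') (c - c') (d - d')"
    and "r \<cdot>\<^sub>m mat2 a b c d = mat2 (r * a) (r * b) (r * c) (r * d)"
    and "mat2 a b c d * mat2 a' b' c' d' =
      mat2 (a * a' + b * c') (a * b' + b * d') (c * a' + d * c') (c * b' + d * d')"
  by (rule mat2_eqI; simp add: scalar_prod_def sum_upto_2_3 carrier_matI)+

lemma mat3_arith:
  fixes a b c d e f g h i :: "'a::comm_ring_1"
  shows "mat3 a b c d e f g h i + mat3 a' b' c' d' e' f' g' h' i' =
      mat3 (a + a') (b + b') (c + c') (d + d') (e + e') (f + f') (g + g') (h + h') (i + i')"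
    and "mat3 a b c d e f g h i - mat3 a' b' c' d' e' f' g' h' i' =
      mat3 (a - a') (b - b') (c - c') (d - d') (e - e') (f - f') (g - g') (h - h') (i - i')"
    and "- mat3 a b c d e f g h i = mat3 (- a) (- b) (- c) (- d) (- e) (- f) (- g) (- h) (- i)"
    and "r \<cdot>\<^sub>m mat3 a b c d e f g h i =
      mat3 (r * a) (r * b) (r * c) (r * d) (r * e) (r * f) (r * g) (r * h) (r * i)"
    and "mat3 a b c d e f g h i * mat3 a' b' c' d' e' f' g' h' i' =
      mat3 (a * a' + b * d' + c * g') (a * b' + b * e' + c * h') (a * c' + b * f' + c * i')
        (d * a' + e * d' + f * g') (d * b' + e * e' + f * h') (d * c' + e * f' + f * i')
        (g * a' + h * d' + i * g') (g * b' + h * e' + i * h') (g * c' + h * f' + i * i')"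
  by (rule mat3_eqI; simp add: scalar_prod_def sum_upto_2_3 carrier_matI)+

lemma mat_delete_mat3_col0:
  "mat_delete (mat3 a b c d e f g h i) 0 0 = mat2 e f h i"
  "mat_delete (mat3 a b c d e f g h i) (Suc 0) 0 = mat2 b c h i"
  "mat_delete (mat3 a b c d e f g h i) 2 0 = mat2 b c e f"
  by (rule mat2_eqI; simp add: mat_delete_def flip: numeral_2_eq_2)+

lemma det_mat2: "det (mat2 a b c d :: 'a::comm_ring_1 mat) = a * d - b * c"
proof -
  have "mat_delete (mat2 a b c d) 0 0 = mat 1 1 (\<lambda>_. d)"
    "mat_delete (mat2 a b c d) (Suc 0) 0 = mat 1 1 (\<lambda>_. b)"
    by (rule eq_matI; simp add: mat_delete_def)+
  moreover have "det (mat 1 1 (\<lambda>_. r)) = r" for r :: 'a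
    by (subst det_single) simp_all
  ultimately have "(\<Sum>i\<in>{0..<2}. mat2 a b c d $$ (i, 0) * cofactor (mat2 a b c d) i 0) = a * d - b * c"
    by (simp only: sum_upto_2_3 cofactor_def) (simp add: algebra_simps)
  then show ?thesis
    by (subst laplace_expansion_column[where j = 0 and n = 2]) (simp_all add: atLeast0LessThan)
qed

lemma det_mat3:
  "det (mat3 a b c d e f g h i :: 'a::comm_ring_1 mat) =
    a * (e * i - f * h) - d * (b * i - c * h) + g * (b * f - c * e)"
proof -
  let ?M = "mat3 a b c d e f g h i"
  have "(\<Sum>j\<in>{0..<3}. ?M $$ (j, 0) * cofactor ?M j 0) =
    a * (e * i - f * h) - d * (b * i - c * h) + g * (b * f - c * e)"
    by (simp only: sum_upto_2_3 cofactor_def mat_delete_mat3_col0 det_mat2 mat3_index) (simp add: algebra_simps)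
  then show ?thesis
    by (subst laplace_expansion_column[where j = 0 and n = 3]) (simp_all add: atLeast0LessThan)
qed

lemma map_mat3:
  "map_mat r (mat3 a b c d e f g h i) = mat3 (r a) (r b) (r c) (r d) (r e) (r f) (r g) (r h) (r i)"
  by (rule mat3_eqI) simp_all

lemma mat_trace_mat2 [simp]: "mat_trace (mat2 a b c d) = a + d"
  by (simp add: mat_trace_def numeral_2_eq_2)

text \<open>The matrix of \<open>X \<mapsto> A X A\<^sup>-\<^sup>1\<close> in the coordinates \<open>X = (x\<^sub>1, x\<^sub>2; x\<^sub>3, -x\<^sub>1)\<close>,
  for \<open>A = (a, b; c, d)\<close> of determinant 1.\<close>

definition ad3 :: "'a \<Rightarrow> 'a \<Rightarrow> 'a \<Rightarrow> 'a \<Rightarrow> 'a::comm_ring_1 mat" where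
  "ad3 a b c d = mat3 (a * d + b * c) (- (a * c)) (b * d) (- (2 * a * b)) (a * a) (- (b * b))
     (2 * c * d) (- (c * c)) (d * d)"

lemma ad3_carrier [simp]: "ad3 a b c d \<in> carrier_mat 3 3"
  by (simp add: ad3_def)

text \<open>The entries of \<open>ad3\<close> are those of X -> A X adj(A), and the adjugate
  reverses products. Multiplicativity is therefore a polynomial identity in the entries.\<close>

lemma ad3_mult:
  "ad3 a b c d * ad3 a' b' c' d' =
    ad3 (a * a' + b * c') (a * b' + b * d') (c * a' + d * c') (c * b' + d * d')"
  by (simp add: ad3_def mat3_arith algebra_simps)

lemma ad3_one: "ad3 1 0 0 1 = 1\<^sub>m 3"
  by (simp add: ad3_def mat3_one)

text \<open>If \<mu> and \<mu>^-1 are the eigenvalues of A, those of Ad(A) are 1, \<mu>^2 and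
  \<mu>^-2, and \<mu>^2 + \<mu>^-2 is the squared trace minus 2.\<close>

lemma det_one_minus_ad3:
  assumes "a * d - b * c = (1 :: 'a::comm_ring_1)"
  shows "det (1\<^sub>m 3 - s \<cdot>\<^sub>m ad3 a b c d) = (1 - s) * (1 - ((a + d)\<^sup>2 - 2) * s + s\<^sup>2)"
proof -
  \<comment> \<open>Homogenised with powers of the determinant, the formula holds for all entries
    and ring normalisation proves it; the determinant is set to 1 afterwards.\<close>
  have "det (1\<^sub>m 3 - s \<cdot>\<^sub>m ad3 a b c d) =
      (1 - s * (a * d - b * c)) * (1 - ((a + d)\<^sup>2 - 2 * (a * d - b * c)) * s + (s * (a * d - b * c))\<^sup>2)"
    by (simp add: ad3_def mat3_arith mat3_one det_mat3 power2_eq_square algebra_simps)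
  then show ?thesis
    using assms by simp
qed

section \<open>Determinants for the normal form\<close>

text \<open>The matrix determinant lemma: subtracting \<open>r\<close> times column times row
  changes the determinant by \<open>r\<close> times row * adjugate * column, since an update of rank
  one contributes nothing of higher degree in \<open>r\<close>.\<close>

lemma det_mat3_rank_one_update:
  fixes r :: "'a::comm_ring_1"
  shows "det (mat3 (a - r * u * x) (b - r * u * y) (c - r * u * z)
      (d - r * v * x) (e - r * v * y) (f - r * v * z)
      (g - r * w * x) (h - r * w * y) (i - r * w * z)) =
    det (mat3 a b c d e f g h i) - r * (
      x * (u * (e * i - f * h) - v * (b * i - c * h) + w * (b * f - c * e))
    - y * (u * (d * i - f * g) - v * (a * i - c * g) + w * (a * f - c * d))
    + z * (u * (d * h - e * g) - v * (a * h - b * g) + w * (a * e - b * d)))"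
  unfolding det_mat3 by (simp add: algebra_simps)

text \<open>
  The matrix below is \<open>1 - t \<alpha> - t\<^sup>-\<^sup>1 \<beta>\<^sup>-\<^sup>1 + (k / 2) T\<close> with
  \<open>T X = B\<^sup>-\<^sup>1 A X B A\<^sup>-\<^sup>1 + A B\<^sup>-\<^sup>1 X A\<^sup>-\<^sup>1 B\<close> and \<open>l = m\<^sup>2\<close>. The letters \<open>li\<close>, \<open>ti\<close>, \<open>h\<close> stand for
  \<open>l\<^sup>-\<^sup>1\<close>, \<open>t\<^sup>-\<^sup>1\<close>, \<open>1 / 2\<close>; given by equations, they make the claims ideal membership problems.
\<close>

lemma det_riley_matrix:
  fixes l li q t ti k :: "'a::idom"
  assumes "l * li = 1" "t * ti = 1" "k = l + li - 1 + q" "2 * h = (1::'a)" "y = 2 - q" "X = l + 2 + li"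
  shows "det (mat3
      (1 - t - ti + k * h * (1 - q * li + (1 - q)\<^sup>2 - q * l))
      (k * h * (q + (1 - q) * q * l) - q * ti)
      (k * h * (li + 1 - q) - t * li)
      (2 * t - k * (1 + (1 - q) * li))
      (1 - t * l - ti * li + k * (1 - q))
      (t * li - k * li)
      (2 * q * l * ti - k * (q * l + q * (1 - q)))
      (q\<^sup>2 * l * ti - k * q\<^sup>2 * l)
      (1 - t * li - ti * l + k * (1 - q)))
    = - ((t - 1)\<^sup>2 * (t\<^sup>2 - (X - 2) * t + 1) * ti ^ 3 *
        (t\<^sup>2 + (2 - (X - y) - h * (X - 1 - y) * y * (X - y)) * t + 1))"
  using assms unfolding det_mat3 by Groebner_Basis.algebra

text \<open>This is the product row * adjugate * column of the rank-one update, for the matrix of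
  \<open>det_riley_matrix\<close>. The row (\<open>x1\<close>, \<open>x2\<close>, \<open>x3\<close>)
  is X -> tr(W X), and the column (\<open>u\<close>, \<open>v\<close>, \<open>w\<close>) is the
  traceless part of B^-1 A B A^-1. The result shares with \<open>det_riley_matrix\<close> the factor
  (t - 1)^2 (t^2 - (X - 2) t + 1), most of which later cancels against the denominator.\<close>

lemma riley_matrix_adjugate:
  fixes l li q t ti k r :: "'a::idom"
  assumes "l * li = 1" "t * ti = 1" "2 * h = (1::'a)" "k = l + li - 1 + q" "y = 2 - q" "X = l + 2 + li"
   and "x1 = 1 + q * l - q * li - (1 - q)\<^sup>2" "x3 = li - (1 - q)" "x2 = q - q * l * (1 - q)"
   and "u = h * (1 + q * li - q * l - (1 - q)\<^sup>2)" "v = (1 - q) * li - 1" "w = q * (1 - q) - q * l"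
   and "a = 1 - t - ti + k * h * (1 - q * li + (1 - q)\<^sup>2 - q * l)"
      "b = k * h * (q + (1 - q) * q * l) - q * ti"  "c = k * h * (li + 1 - q) - t * li"
     "d = 2 * t - k * (1 + (1 - q) * li)" "e = 1 - t * l - ti * li + k * (1 - q)" "f = t * li - k * li"
     "g = 2 * q * l * ti - k * (q * l + q * (1 - q))" "j = q\<^sup>2 * l * ti - k * q\<^sup>2 * l" "i = 1 - t * li - ti * l + k * (1 - q)"
  shows "x1 * (u * (e * i - f * j) - v * (b * i - c * j) + w * (b * f - c * e))
    - x2 * (u * (d * i - f * g) - v * (a * i - c * g) + w * (a * f - c * d))
    + x3 * (u * (d * j - e * g) - v * (a * j - b * g) + w * (a * e - b * d)) =
      h * (y - 2) * (y + 2 - X) * ((t - 1)\<^sup>2 * (t\<^sup>2 - (X - 2) * t + 1)) * ti\<^sup>2 * y * (X - y)"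
  using assms(1-3) unfolding assms(4-) by Groebner_Basis.algebra

text \<open>The matrix of \<open>X \<mapsto> A X - X A\<close> in the coordinates of \<open>ad3\<close>, for \<open>A = (a, b; c, d)\<close>.\<close>

definition comm3 :: "'a \<Rightarrow> 'a \<Rightarrow> 'a \<Rightarrow> 'a \<Rightarrow> 'a::comm_ring_1 mat" where
  "comm3 a b c d = mat3 0 (- c) b (- (2 * b)) (a - d) 0 (2 * c) 0 (- (a - d))"

definition poly3 :: "'a::comm_ring_1 mat \<Rightarrow> 'a \<Rightarrow> 'a \<Rightarrow> 'a \<Rightarrow> 'a mat" where
  "poly3 K n p r = n \<cdot>\<^sub>m 1\<^sub>m 3 + p \<cdot>\<^sub>m K + r \<cdot>\<^sub>m (K * K)"

lemma comm3_carrier [simp]: "comm3 a b c d \<in> carrier_mat 3 3"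
  by (simp add: comm3_def)

lemma poly3_carrier [simp]: "K \<in> carrier_mat 3 3 \<Longrightarrow> poly3 K n p r \<in> carrier_mat 3 3"
  by (simp add: poly3_def)

text \<open>The cubic and quartic terms are reduced by \<kappa>^3 = \<Delta> \<kappa>: the
  eigenvalues of the commutator operator are 0 and the two differences of eigenvalues of the matrix,
  whose square is \<Delta>.\<close>

lemma poly3_comm3_mult:
  assumes "\<Delta> = (a - d)\<^sup>2 + 4 * b * c"
  shows "poly3 (comm3 a b c d) n p r * poly3 (comm3 a b c d) n' p' r' =
    poly3 (comm3 a b c d) (n * n') (n * p' + p * n' + (p * r' + r * p') * \<Delta>)
      (n * r' + p * p' + r * n' + r * r' * \<Delta>)"
  unfolding assms
  by (simp add: poly3_def comm3_def mat3_one mat3_arith power2_eq_square algebra_simps)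

text \<open>The eigenvalues are n, n + r \<Delta> + p \<delta> and n + r \<Delta> - p \<delta>,
  where \<delta>^2 = \<Delta>.\<close>

lemma det_poly3_comm3:
  fixes a :: "'a::idom"
  assumes "\<Delta> = (a - d)\<^sup>2 + 4 * b * c"
  shows "det (poly3 (comm3 a b c d) n p r) = n * ((n + r * \<Delta>)\<^sup>2 - p\<^sup>2 * \<Delta>)"
  unfolding assms poly3_def comm3_def mat3_one mat3_arith det_mat3
  by Groebner_Basis.algebra

text \<open>Expand (S W - S') X adj(S W - S') with adj(W) = tr(W) - W. The term W X W is expressed
  through \<kappa>^2 by means of W^2 = tr(W) W - 1, and the constant coefficient is the determinant
  of S W - S'.\<close>

lemma ad3_eq_poly3:
  fixes a :: "'a::idom"
  assumes "2 * h = 1" "a * d - b * c = 1"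
  shows "ad3 (S * a - S') (S * b) (S * c) (S * d - S') =
    poly3 (comm3 a b c d) (S\<^sup>2 + S'\<^sup>2 - (a + d) * S * S') (h * S\<^sup>2 * (a + d) - S * S') (h * S\<^sup>2)"
  using assms unfolding ad3_def poly3_def comm3_def mat3_one mat3_arith mat3_eq_iff
  by (intro conjI; Groebner_Basis.algebra)

text \<open>Since Y (X S Y - 1) = (Y X S - 1) Y, the outer factors can be brought together;
  splitting off S on the right then leaves only its inverse in the matrix. The factor
  \<open>H\<close> of determinant 1 leaves room to simplify the product Y X.\<close>

lemma det_mult_swap:
  fixes X :: "'a::field mat"
  assumes X: "X \<in> carrier_mat n n" and S: "S \<in> carrier_mat n n" and S': "S' \<in> carrier_mat n n"
    and Y: "Y \<in> carrier_mat n n" and H: "H \<in> carrier_mat n n"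
    and "det Y \<noteq> 0" "det H = 1" "S' * S = 1\<^sub>m n"
  shows "det (X * S * Y - 1\<^sub>m n) = det (H * Y * X - H * S') * det S"
proof -
  note c = X S S' Y H mult_carrier_mat[of _ n n _ n] minus_carrier_mat[of _ n n] one_carrier_mat
  note assoc = assoc_mult_mat[of _ n n _ n _ n]
  have "Y * (X * S * Y - 1\<^sub>m n) = Y * (X * S * Y) - Y * 1\<^sub>m n"
    by (rule mult_minus_distrib_mat[of _ n n _ n]) (simp_all add: c)
  also have "\<dots> = Y * X * S * Y - 1\<^sub>m n * Y"
    by (simp add: c assoc right_mult_one_mat[OF Y] left_mult_one_mat[OF Y])
  also have "\<dots> = (Y * X * S - 1\<^sub>m n) * Y"
    by (rule minus_mult_distrib_mat[symmetric, of _ n n _ _ n]) (simp_all add: c)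
  finally have "det (Y * (X * S * Y - 1\<^sub>m n)) = det ((Y * X * S - 1\<^sub>m n) * Y)"
    by simp
  then have "det Y * det (X * S * Y - 1\<^sub>m n) = det (Y * X * S - 1\<^sub>m n) * det Y"
    by (simp only: det_mult[of _ n] c)
  then have "det (X * S * Y - 1\<^sub>m n) = det (Y * X * S - 1\<^sub>m n)"
    using assms(6) by simp
  also have "\<dots> = det (H * (Y * X * S - 1\<^sub>m n))"
    using assms(7) by (simp only: det_mult[of _ n] c) simp
  also have "H * (Y * X * S - 1\<^sub>m n) = H * (Y * X * S) - H * 1\<^sub>m n"
    by (rule mult_minus_distrib_mat[of _ n n _ n]) (simp_all add: c)
  also have "\<dots> = H * Y * X * S - H * S' * S"
    using H assms(8) by (simp add: c assoc)
  also have "\<dots> = (H * Y * X - H * S') * S"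
    by (rule minus_mult_distrib_mat[symmetric, of _ n n _ _ n]) (simp_all add: c)
  also have "det \<dots> = det (H * Y * X - H * S') * det S"
    by (rule det_mult[of _ n]) (simp_all only: c)
  finally show ?thesis .
qed

text \<open>The explicit matrices on the left are Ad(B^-1), which equals \<open>H\<close> Ad(B A^-1
  B^-1), and Ad(B); here \<open>l\<close> is m^2. The terms in \<open>\<rho>\<close> come from h
  \<rho> (z^2 - 4 - K^2), which sends X to \<rho> tr(W X) times the traceless part of W. Applying
  \<open>H\<close> turns that part into the traceless part of B^-1 A B A^-1, hence the rank-one term
  in every entry.\<close>

lemma riley_matrix_eq:
  fixes l :: "'a::field"
  assumes l: "l * li = 1" and t: "t * ti = 1" and h: "2 * h = (1::'a)"
    and k: "k = l + li - 1 + q" and z: "z = 2 + q * (l + li - 2 + q)"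
    and K: "K = comm3 (1 + q * l) (li - (1 - q)) (q - q * l * (1 - q)) (q * li + (1 - q)\<^sup>2)"
    and H: "H = ad3 (1 - q) 1 (- q) 1"
  shows "(H - ti \<cdot>\<^sub>m mat3 1 q 0 0 li 0 (- (2 * q * l)) (- (q\<^sup>2 * l)) l) *
         (1\<^sub>m 3 - t \<cdot>\<^sub>m mat3 1 (- (q * l)) 0 0 l 0 (2 * q) (- (q\<^sup>2 * l)) li)
        - H * poly3 K (1 - z * h * k + h * \<rho> * (z\<^sup>2 - 4)) (- (h * k)) (- (h * \<rho>)) =
    mat3
      (1 - t - ti + k * h * (1 - q * li + (1 - q)\<^sup>2 - q * l)
        - \<rho> * (h * (1 + q * li - q * l - (1 - q)\<^sup>2)) * (1 + q * l - q * li - (1 - q)\<^sup>2))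
      (k * h * (q + (1 - q) * q * l) - q * ti
        - \<rho> * (h * (1 + q * li - q * l - (1 - q)\<^sup>2)) * (q - q * l * (1 - q)))
      (k * h * (li + 1 - q) - t * li
        - \<rho> * (h * (1 + q * li - q * l - (1 - q)\<^sup>2)) * (li - (1 - q)))
      (2 * t - k * (1 + (1 - q) * li)
        - \<rho> * ((1 - q) * li - 1) * (1 + q * l - q * li - (1 - q)\<^sup>2))
      (1 - t * l - ti * li + k * (1 - q)
        - \<rho> * ((1 - q) * li - 1) * (q - q * l * (1 - q)))
      (t * li - k * li
        - \<rho> * ((1 - q) * li - 1) * (li - (1 - q)))
      (2 * q * l * ti - k * (q * l + q * (1 - q))
        - \<rho> * (q * (1 - q) - q * l) * (1 + q * l - q * li - (1 - q)\<^sup>2))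
      (q\<^sup>2 * l * ti - k * q\<^sup>2 * l
        - \<rho> * (q * (1 - q) - q * l) * (q - q * l * (1 - q)))
      (1 - t * li - ti * l + k * (1 - q)
        - \<rho> * (q * (1 - q) - q * l) * (li - (1 - q)))"
  using l t h unfolding k z K H poly3_def ad3_def comm3_def mat3_one mat3_arith mat3_eq_iff
  by (intro conjI; Groebner_Basis.algebra)

text \<open>With \<open>\<Sigma> = n + p \<kappa> + r \<kappa>\<^sup>2\<close>, these are the coefficients of \<open>\<Sigma>\<^sup>-\<^sup>1 = c\<^sub>0 + c\<^sub>1 \<kappa> + c\<^sub>2 \<kappa>\<^sup>2\<close>.\<close>

lemma sigma_inverse_coeffs:
  fixes n :: "'a::idom"
  assumes h: "2 * h = (1::'a)" and s: "s * (1 + k\<^sup>2 - z * k) = 1" and p: "p = h * k * s"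
    and \<Delta>: "\<Delta> = z\<^sup>2 - 4" and r: "n + r * \<Delta> = s * (1 - h * z * k)"
    and \<rho>: "n * \<rho> = 2 * ((1 - h * z * k) * r - h\<^sup>2 * k\<^sup>2 * s)"
    and c: "c\<^sub>0 = 1 - z * h * k + h * \<rho> * \<Delta>" "c\<^sub>1 = - (h * k)" "c\<^sub>2 = - (h * \<rho>)"
  shows "c\<^sub>0 * n = 1"
    and "c\<^sub>0 * p + c\<^sub>1 * n + (c\<^sub>1 * r + c\<^sub>2 * p) * \<Delta> = 0"
    and "c\<^sub>0 * r + c\<^sub>1 * p + c\<^sub>2 * n + c\<^sub>2 * r * \<Delta> = 0"
    and "n * ((n + r * \<Delta>)\<^sup>2 - p\<^sup>2 * \<Delta>) = n * s"
    and "h * \<rho> * n * \<Delta> = 1 - n * (1 - h * z * k)"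
proof -
  have "h * \<rho> * n = h * (n * \<rho>)"
    by (simp only: ac_simps)
  also have "\<dots> = 2 * h * ((1 - h * z * k) * r - h\<^sup>2 * k\<^sup>2 * s)"
    unfolding \<rho> by (simp only: ac_simps)
  finally have a: "h * \<rho> * n = (1 - h * z * k) * r - h\<^sup>2 * k\<^sup>2 * s"
    unfolding h by simp
  \<comment> \<open>The bracket is 1 + k^2 - z k again, by completing the square.\<close>
  have b: "s * ((1 - h * z * k)\<^sup>2 - h\<^sup>2 * k\<^sup>2 * \<Delta>) = 1"
    using h s unfolding \<Delta> by Groebner_Basis.algebra
  have "c\<^sub>0 * n = (1 - h * z * k) * n + (h * \<rho> * n) * \<Delta>"
    unfolding c by (simp add: algebra_simps)
  also have "\<dots> = (1 - h * z * k) * (n + r * \<Delta>) - h\<^sup>2 * k\<^sup>2 * s * \<Delta>"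
    unfolding a by (simp add: algebra_simps)
  also have "\<dots> = 1"
    unfolding r using b by (simp add: algebra_simps power2_eq_square)
  finally show "c\<^sub>0 * n = 1" .
  have "c\<^sub>0 * p + c\<^sub>1 * n + (c\<^sub>1 * r + c\<^sub>2 * p) * \<Delta> = h * k * (s * (1 - h * z * k) - (n + r * \<Delta>))"
    unfolding c p by (simp add: algebra_simps)
  then show "c\<^sub>0 * p + c\<^sub>1 * n + (c\<^sub>1 * r + c\<^sub>2 * p) * \<Delta> = 0"
    unfolding r by simp
  have "c\<^sub>0 * r + c\<^sub>1 * p + c\<^sub>2 * n + c\<^sub>2 * r * \<Delta> =
      (1 - h * z * k) * r - h\<^sup>2 * k\<^sup>2 * s - h * \<rho> * n"
    unfolding c p by (simp add: algebra_simps power2_eq_square)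
  then show "c\<^sub>0 * r + c\<^sub>1 * p + c\<^sub>2 * n + c\<^sub>2 * r * \<Delta> = 0"
    unfolding a by simp
  have "h * \<rho> * n * \<Delta> = (1 - h * z * k) * (r * \<Delta>) - h\<^sup>2 * k\<^sup>2 * s * \<Delta>"
    unfolding a by (simp add: algebra_simps)
  also have "r * \<Delta> = s * (1 - h * z * k) - n"
    using r by (simp add: algebra_simps)
  also have "(1 - h * z * k) * (s * (1 - h * z * k) - n) - h\<^sup>2 * k\<^sup>2 * s * \<Delta> = 1 - n * (1 - h * z * k)"
    using b by (simp add: algebra_simps power2_eq_square)
  finally show "h * \<rho> * n * \<Delta> = 1 - n * (1 - h * z * k)" .
  have "(n + r * \<Delta>)\<^sup>2 - p\<^sup>2 * \<Delta> = s"
    unfolding r p unfolding \<Delta> using h s by Groebner_Basis.algebra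
  then show "n * ((n + r * \<Delta>)\<^sup>2 - p\<^sup>2 * \<Delta>) = n * s"
    by simp
qed

lemma riley_det:
  fixes m mi q t ti s h :: "'a::field"
  assumes m: "m * mi = 1" and t: "t * ti = 1" and h: "2 * h = (1::'a)" and n: "n \<noteq> 0"
    and x: "x = m + mi" and y: "y = 2 - q"
    and k: "k = x\<^sup>2 - 1 - y" and z: "z = 2 + (y - 2) * (y + 2 - x\<^sup>2)"
    and s: "s * (1 + k\<^sup>2 - z * k) = 1"
    and p: "p = h * k * s" and r: "n + r * (z\<^sup>2 - 4) = s * (1 - h * z * k)"
    and W: "mat2 m 0 (q * m) mi * mat2 mi (- mi) 0 m * mat2 mi 0 (- (q * m)) m * mat2 m mi 0 mi = mat2 wa wb wc wd"
    and G: "G = ad3 m 0 (q * m) mi * ad3 mi (- mi) 0 m * ad3 mi 0 (- (q * m)) m"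
    and Y: "det (1\<^sub>m 3 - ti \<cdot>\<^sub>m G) \<noteq> 0"
  shows "det ((1\<^sub>m 3 - t \<cdot>\<^sub>m ad3 m 0 (q * m) mi) * poly3 (comm3 wa wb wc wd) n p r * (1\<^sub>m 3 - ti \<cdot>\<^sub>m G) - 1\<^sub>m 3)
      * (z + 2) =
    - (s * ((t - 1)\<^sup>2 * (t\<^sup>2 - (x\<^sup>2 - 2) * t + 1)) * ti ^ 3 *
      ((z + 2) * (n * t\<^sup>2 + n) + ((2 * n - 1) * y\<^sup>2 + y * x\<^sup>2 - 2 * n * x\<^sup>2 * (x\<^sup>2 - 2)) * t))"
proof -
  define l li where "l = m * m" and "li = mi * mi"
  have l: "l * li = 1"
    using m unfolding l_def li_def by Groebner_Basis.algebra
  have x2: "x\<^sup>2 = l + 2 + li"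
    using m unfolding x l_def li_def by Groebner_Basis.algebra
  have k': "k = l + li - 1 + q" and z': "z = 2 + q * (l + li - 2 + q)"
    unfolding k z x2 y by (simp_all add: algebra_simps)
  define K where "K = comm3 (1 + q * l) (li - (1 - q)) (q - q * l * (1 - q)) (q * li + (1 - q)\<^sup>2)"
  have W': "mat2 wa wb wc wd = mat2 (1 + q * l) (li - (1 - q)) (q - q * l * (1 - q)) (q * li + (1 - q)\<^sup>2)"
    unfolding W[symmetric] l_def li_def mat2_arith mat2_eq_iff
    using m by (intro conjI; Groebner_Basis.algebra)
  have K: "comm3 wa wb wc wd = K"
    using W' by (simp add: K_def)
  define \<Delta> where "\<Delta> = z\<^sup>2 - 4"
  have \<Delta>: "\<Delta> = ((1 + q * l) - (q * li + (1 - q)\<^sup>2))\<^sup>2 + 4 * (li - (1 - q)) * (q - q * l * (1 - q))"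
    unfolding \<Delta>_def z' using l by Groebner_Basis.algebra
  \<comment> \<open>\<open>\<rho>\<close> is fixed by the vanishing of the \<kappa>^2 coefficient of
    S' S. Only \<open>n\<close> is divided by, so \<Delta> = 0 is allowed.\<close>
  define \<rho> where "\<rho> = 2 * ((1 - h * z * k) * r - h\<^sup>2 * k\<^sup>2 * s) / n"
  have \<rho>: "n * \<rho> = 2 * ((1 - h * z * k) * r - h\<^sup>2 * k\<^sup>2 * s)"
    using n by (simp add: \<rho>_def)
  note coeffs = sigma_inverse_coeffs[OF h s p \<Delta>_def r[folded \<Delta>_def] \<rho> HOL.refl HOL.refl HOL.refl]
  \<comment> \<open>This is Ad(A B^-1), chosen so that \<open>H * G\<close> collapses to
    Ad(B^-1).\<close>
  define H where "H = ad3 (1 - q) 1 (- q) 1"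
  define S S' where "S = poly3 K n p r"
    and "S' = poly3 K (1 - z * h * k + h * \<rho> * \<Delta>) (- (h * k)) (- (h * \<rho>))"
  have carr: "K \<in> carrier_mat 3 3" "H \<in> carrier_mat 3 3" "G \<in> carrier_mat 3 3"
    by (simp_all add: K_def H_def G ad3_mult)
  have B: "ad3 m 0 (q * m) mi = mat3 1 (- (q * l)) 0 0 l 0 (2 * q) (- (q\<^sup>2 * l)) li"
    using m unfolding ad3_def l_def li_def by (simp add: algebra_simps power2_eq_square)
  have Bi: "ad3 mi 0 (- (q * m)) m = mat3 1 q 0 0 li 0 (- (2 * q * l)) (- (q\<^sup>2 * l)) l"
    using m unfolding ad3_def l_def li_def by (simp add: algebra_simps power2_eq_square)
  have HG: "H * G = mat3 1 q 0 0 li 0 (- (2 * q * l)) (- (q\<^sup>2 * l)) l"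
    unfolding G H_def ad3_mult Bi[symmetric]
    by (rule arg_cong4[where f = ad3]; insert m; simp; Groebner_Basis.algebra)
  have detH: "det H = 1"
    unfolding H_def ad3_def det_mat3 by Groebner_Basis.algebra
  have S'S: "S' * S = 1\<^sub>m 3"
    unfolding S_def S'_def K_def poly3_comm3_mult[OF \<Delta>] coeffs
    by (simp add: poly3_def comm3_def mat3_arith mat3_one)
  have detS: "det S = n * s"
    unfolding S_def K_def det_poly3_comm3[OF \<Delta>] coeffs ..
  have "H * (1\<^sub>m 3 - ti \<cdot>\<^sub>m G) = H * 1\<^sub>m 3 - H * (ti \<cdot>\<^sub>m G)"
    by (rule mult_minus_distrib_mat[of _ 3 3 _ 3]) (simp_all add: carr)
  also have "\<dots> = H - ti \<cdot>\<^sub>m (H * G)"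
    by (simp add: right_mult_one_mat[OF carr(2)] mult_smult_distrib[OF carr(2,3)])
  finally have HY: "H * (1\<^sub>m 3 - ti \<cdot>\<^sub>m G) = H - ti \<cdot>\<^sub>m mat3 1 q 0 0 li 0 (- (2 * q * l)) (- (q\<^sup>2 * l)) l"
    unfolding HG .
  have "det ((1\<^sub>m 3 - t \<cdot>\<^sub>m ad3 m 0 (q * m) mi) * S * (1\<^sub>m 3 - ti \<cdot>\<^sub>m G) - 1\<^sub>m 3) =
    det (H * (1\<^sub>m 3 - ti \<cdot>\<^sub>m G) * (1\<^sub>m 3 - t \<cdot>\<^sub>m ad3 m 0 (q * m) mi) - H * S') * det S"
    by (rule det_mult_swap[where n = 3])
      (use Y detH S'S in \<open>simp_all add: carr S_def S'_def minus_carrier_mat\<close>)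
  also have "\<dots> = (- ((t - 1)\<^sup>2 * (t\<^sup>2 - (x\<^sup>2 - 2) * t + 1) * ti ^ 3 *
        (t\<^sup>2 + (2 - (x\<^sup>2 - y) - h * (x\<^sup>2 - 1 - y) * y * (x\<^sup>2 - y)) * t + 1))
      - \<rho> * (h * (y - 2) * (y + 2 - x\<^sup>2) * ((t - 1)\<^sup>2 * (t\<^sup>2 - (x\<^sup>2 - 2) * t + 1)) * ti\<^sup>2 * y * (x\<^sup>2 - y))) * (n * s)"
    unfolding HY B S'_def \<Delta>_def riley_matrix_eq[OF l t h k' z' K_def H_def] det_mat3_rank_one_update
      det_riley_matrix[OF l t k' h y x2] riley_matrix_adjugate[OF l t h k' y x2 HOL.refl HOL.refl HOL.refl HOL.refl HOL.refl HOL.refl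
        HOL.refl HOL.refl HOL.refl HOL.refl HOL.refl HOL.refl HOL.refl HOL.refl HOL.refl] detS ..
  finally have D: "det ((1\<^sub>m 3 - t \<cdot>\<^sub>m ad3 m 0 (q * m) mi) * S * (1\<^sub>m 3 - ti \<cdot>\<^sub>m G) - 1\<^sub>m 3) = \<dots>" .
  have ti2: "ti\<^sup>2 = ti ^ 3 * t"
    using t by Groebner_Basis.algebra
  have zy: "h * (y - 2) * (y + 2 - x\<^sup>2) = h * (z - 2)"
    unfolding z by simp
  \<comment> \<open>The rank-one correction carries the factor \<open>z - 2\<close>. Multiplication
    by \<open>z + 2\<close> produces \<open>h * \<rho> * n * (z\<^sup>2 - 4)\<close>, whose value is
    known without reference to \<open>r\<close>.\<close>
  have collect: "(- (b * e * (t\<^sup>2 + c * t + 1)) - \<rho> * (h * (z - 2) * b * (e * t) * y * w)) * (n * s) * (z + 2) =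
      - (s * b * e * ((z + 2) * (n * t\<^sup>2 + n) + (n * c * (z + 2) + h * \<rho> * n * (z\<^sup>2 - 4) * y * w) * t))"
    for b c e w
    by Groebner_Basis.algebra
  have "n * (2 - (x\<^sup>2 - y) - h * (x\<^sup>2 - 1 - y) * y * (x\<^sup>2 - y)) * (z + 2) + h * \<rho> * n * \<Delta> * y * (x\<^sup>2 - y) =
      (2 * n - 1) * y\<^sup>2 + y * x\<^sup>2 - 2 * n * x\<^sup>2 * (x\<^sup>2 - 2)"
    unfolding coeffs unfolding k z using h by Groebner_Basis.algebra
  then show ?thesis
    unfolding K S_def[symmetric] D \<Delta>_def zy ti2 collect by simp
qed

section \<open>Fox calculus over a presented group\<close>

lemma free_grp_simps [simp]:
  "x \<otimes>\<^bsub>free_grp l\<^esub> y = x + y" "\<one>\<^bsub>free_grp l\<^esub> = 0"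
  by (simp_all add: free_grp_def)

lemma gen_in_free_grp [simp]: "i < l \<Longrightarrow> gen i \<in> carrier (free_grp l)"
  by (auto simp: free_grp_def carrier_subgroup_generated intro: generate.incl)

lemma zero_in_free_grp [simp]: "0 \<in> carrier (free_grp l)"
  using group.is_monoid[OF group_free_grp] monoid.one_closed by fastforce

lemma plus_in_free_grp [simp]:
  "x \<in> carrier (free_grp l) \<Longrightarrow> y \<in> carrier (free_grp l) \<Longrightarrow> x + y \<in> carrier (free_grp l)"
  using monoid.m_closed[OF group.is_monoid[OF group_free_grp], of x l y] by simp

lemma inv_free_grp [simp]:
  assumes "x \<in> carrier (free_grp l)"
  shows "inv\<^bsub>free_grp l\<^esub> x = - x"
proof -
  have "inv\<^bsub>free_grp l\<^esub> x \<otimes>\<^bsub>free_grp l\<^esub> x = \<one>\<^bsub>free_grp l\<^esub>"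
    using assms by (rule group.l_inv[OF group_free_grp])
  then show ?thesis
    by (simp add: eq_neg_iff_add_eq_0)
qed

lemma uminus_in_free_grp [simp]: "x \<in> carrier (free_grp l) \<Longrightarrow> - x \<in> carrier (free_grp l)"
  using group.inv_closed[OF group_free_grp, of x l] by simp

lemma minus_in_free_grp [simp]:
  "x \<in> carrier (free_grp l) \<Longrightarrow> y \<in> carrier (free_grp l) \<Longrightarrow> x - y \<in> carrier (free_grp l)"
  by (metis diff_conv_add_uminus plus_in_free_grp uminus_in_free_grp)

lemma free_grp_induct [consumes 1, case_names zero gen uminus plus]:
  assumes "x \<in> carrier (free_grp l)"
    and "P 0" "\<And>i. i < l \<Longrightarrow> P (gen i)"
    and "\<And>g. g \<in> carrier (free_grp l) \<Longrightarrow> P g \<Longrightarrow> P (- g)"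
    and "\<And>g h. g \<in> carrier (free_grp l) \<Longrightarrow> h \<in> carrier (free_grp l) \<Longrightarrow>
      P g \<Longrightarrow> P h \<Longrightarrow> P (g + h)"
  shows "P x"
proof -
  let ?F = "\<lparr>carrier = UNIV, mult = (+), one = 0 :: nat free_group\<rparr>"
  have F: "group ?F"
    by (rule groupI) (auto simp: add.assoc intro: left_minus)
  have F_inv: "inv\<^bsub>?F\<^esub> g = - g" for g
    by (rule group.inv_equality[OF F]) auto
  have carr: "carrier (free_grp l) = generate ?F (gen ` {..<l})"
    by (simp add: free_grp_def carrier_subgroup_generated)
  have "x \<in> generate ?F (gen ` {..<l})"
    using assms(1) unfolding carr .
  then show ?thesis
  proof (induction rule: generate.induct)
    case (inv h)
    then obtain i where "i < l" "h = gen i"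
      by blast
    then show ?case
      unfolding F_inv using assms(3,4) by simp
  qed (use assms(2,3,5) in \<open>auto simp: carr\<close>)
qed

lemma fox_zero [simp]: "fox j 0 = 0"
  using fox_mult[of j 0 0] by simp

lemma fox_uminus: "fox j (- g) = - elt (- g) * fox j g"
  using fox_mult[of j "- g" g] by (simp add: eq_neg_iff_add_eq_0)

lemma keys_add_subset:
  "Poly_Mapping.keys x \<subseteq> C \<Longrightarrow> Poly_Mapping.keys y \<subseteq> C \<Longrightarrow> Poly_Mapping.keys (x + y) \<subseteq> C"
  for x y :: "'a \<Rightarrow>\<^sub>0 int"
  using Poly_Mapping.keys_add[of x y] by blast

text \<open>The fundamental formula of Fox calculus. Applied to the relator, it relates the
  numerators for the two choices of deleted block column.\<close>

lemma fox_fundamental: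
  assumes "g \<in> carrier (free_grp l)"
  shows "(\<Sum>j<l. fox j g * (elt (gen j) - 1)) = elt g - 1"
  using assms
proof (induction rule: free_grp_induct)
  case (gen i)
  have "(\<Sum>j<l. fox j (gen i) * (elt (gen j) - 1)) = (\<Sum>j<l. if j = i then elt (gen j) - 1 else 0)"
    by (rule sum.cong) (auto simp: fox_gen)
  then show ?case
    using gen by simp
next
  case (uminus g)
  have "(\<Sum>j<l. fox j (- g) * (elt (gen j) - 1)) = - elt (- g) * (\<Sum>j<l. fox j g * (elt (gen j) - 1))"
    by (simp only: fox_uminus sum_distrib_left mult.assoc)
  then show ?case
    unfolding uminus by (simp add: algebra_simps mult_single)
next
  case (plus g h)
  have "(\<Sum>j<l. fox j (g + h) * (elt (gen j) - 1)) =
      (\<Sum>j<l. fox j g * (elt (gen j) - 1)) + elt g * (\<Sum>j<l. fox j h * (elt (gen j) - 1))"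
    by (simp only: fox_mult sum_distrib_left mult.assoc distrib_right sum.distrib)
  then show ?case
    unfolding plus by (simp add: algebra_simps mult_single)
qed simp

text \<open>The type has a generator for every natural number, whereas \<open>Phi_mult\<close> is
  available only for elements supported in the free group of rank \<open>l\<close>; this provides
  its side condition.\<close>

lemma keys_fox:
  assumes "g \<in> carrier (free_grp l)"
  shows "Poly_Mapping.keys (fox j g) \<subseteq> carrier (free_grp l)"
  using assms
proof (induction rule: free_grp_induct)
  case (uminus g)
  have "Poly_Mapping.keys (elt (- g) * fox j g) \<subseteq> carrier (free_grp l)"
    using keys_mult[of "elt (- g)" "fox j g"] uminus by (fastforce dest!: subsetD)
  then show ?case
    by (simp add: fox_uminus)
next
  case (plus g h)
  have "Poly_Mapping.keys (elt g * fox j h) \<subseteq> carrier (free_grp l)"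
    using keys_mult[of "elt g" "fox j h"] plus by (fastforce dest!: subsetD)
  then show ?case
    unfolding fox_mult using plus by (intro keys_add_subset)
qed (auto simp: fox_gen)

lemma normal_closure_normal:
  assumes "group G" "R \<subseteq> carrier G"
  shows "normal_closure G R \<lhd> G" "R \<subseteq> normal_closure G R"
proof -
  interpret group G by fact
  let ?S = "{N. N \<lhd> G \<and> R \<subseteq> N}"
  \<comment> \<open>The whole group belongs to the family, so the intersection is over a nonempty
    family.\<close>
  have "carrier G \<lhd> G"
    by (rule normal_invI) (simp_all add: subgroup_self)
  then have ne: "?S \<noteq> {}"
    using assms by blast
  have "subgroup (\<Inter>?S) G"
    by (rule subgroups_Inter) (use ne in \<open>auto intro: normal_imp_subgroup\<close>)
  then show "normal_closure G R \<lhd> G"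
    unfolding normal_closure_def by (rule normal_invI) (auto intro: normal.inv_op_closed2)
  show "R \<subseteq> normal_closure G R"
    unfolding normal_closure_def by blast
qed

context
  fixes l :: nat and rs :: "nat free_group list"
  assumes rs: "set rs \<subseteq> carrier (free_grp l)"
begin

lemma normal_closure_relators: "normal (normal_closure (free_grp l) (set rs)) (free_grp l)"
  by (rule normal_closure_normal[OF group_free_grp rs])

lemma group_presented_group: "group (presented_group l rs)"
  unfolding presented_group_def by (rule normal.factorgroup_is_group[OF normal_closure_relators])

lemma pres_class_hom: "pres_class l rs \<in> hom (free_grp l) (presented_group l rs)"
  using normal.r_coset_hom_Mod[OF normal_closure_relators]
  unfolding pres_class_def presented_group_def .

lemma pres_class_surj: "carrier (presented_group l rs) = pres_class l rs ` carrier (free_grp l)"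
  unfolding presented_group_def pres_class_def carrier_FactGroup ..

lemma pres_class_relator:
  assumes "r \<in> set rs"
  shows "pres_class l rs r = \<one>\<^bsub>presented_group l rs\<^esub>"
proof -
  have "r \<in> normal_closure (free_grp l) (set rs)"
    using normal_closure_normal(2)[OF group_free_grp rs] assms by blast
  then show ?thesis
    unfolding pres_class_def presented_group_def one_FactGroup
    by (intro subgroup.rcos_const normal_imp_subgroup normal_closure_relators group_free_grp)
qed

end

section \<open>Constants in the rational function field, and linearity and multiplicativity of
  Phi\<close>

lemma tvar_nonzero [simp]: "tvar \<noteq> 0"
  by (simp add: tvar_def)

lemma cst_simps [simp]:
  "cst 0 = 0" "cst 1 = 1" "cst (a + b) = cst a + cst b" "cst (a - b) = cst a - cst b"
  "cst (- a) = - cst a" "cst (a * b) = cst a * cst b"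
  by (simp_all add: cst_def one_pCons
      flip: to_fract_1 to_fract_0 to_fract_add to_fract_diff to_fract_mult to_fract_uminus)

lemma cst_sum: "cst (sum g A) = (\<Sum>i\<in>A. cst (g i))"
  by (induction A rule: infinite_finite_induct) simp_all

context
  fixes l N :: nat and rs :: "nat free_group list" and f :: "nat free_group set \<Rightarrow> int"
    and \<sigma> :: "nat free_group set \<Rightarrow> complex mat"
begin

abbreviation "\<Phi> \<equiv> Phi l rs N f \<sigma>"

lemma Phi_carrier [simp]: "\<Phi> z \<in> carrier_mat N N"
  by (simp add: Phi_def)

lemma Phi_dim [simp]: "dim_row (\<Phi> z) = N" "dim_col (\<Phi> z) = N"
  by (simp_all add: Phi_def)

text \<open>Cancellation can shrink the support of a difference. Summation over a common finite
  superset makes the entries comparable, which gives additivity.\<close>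

lemma Phi_index_superset:
  assumes "finite S" "Poly_Mapping.keys z \<subseteq> S" "p < N" "q < N"
  shows "\<Phi> z $$ (p, q) = (\<Sum>g\<in>S. of_int (Poly_Mapping.lookup z g) * tvar powi f (pres_class l rs g)
       * cst (\<sigma> (pres_class l rs g) $$ (p, q)))"
  using assms unfolding Phi_def
  by (auto intro!: sum.mono_neutral_left simp: in_keys_iff)

lemma Phi_diff: "\<Phi> (x - y) = \<Phi> x - \<Phi> y"
proof (rule eq_matI)
  fix p q assume "p < dim_row (\<Phi> x - \<Phi> y)" "q < dim_col (\<Phi> x - \<Phi> y)"
  then have pq: "p < N" "q < N"
    by simp_all
  let ?S = "Poly_Mapping.keys x \<union> Poly_Mapping.keys y"
  note * = Phi_index_superset[of ?S _ p q, OF _ _ pq]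
  show "\<Phi> (x - y) $$ (p, q) = (\<Phi> x - \<Phi> y) $$ (p, q)"
    using pq by (simp add: * keys_diff lookup_minus left_diff_distrib sum_subtractf)
qed simp_all

lemma Phi_zero: "\<Phi> 0 = 0\<^sub>m N N"
  by (rule eq_matI) (simp_all add: Phi_def)

lemma Phi_elt: "\<Phi> (elt g) = tvar powi f (pres_class l rs g) \<cdot>\<^sub>m map_mat cst (\<sigma> (pres_class l rs g))"
  if "\<sigma> (pres_class l rs g) \<in> carrier_mat N N"
  using that by (intro eq_matI) (simp_all add: Phi_def)

lemma Phi_uminus: "\<Phi> (- x) = - \<Phi> x"
  using Phi_diff[of 0 x] by (simp add: Phi_zero minus_add_uminus_mat[of _ N N])

lemma Phi_add: "\<Phi> (x + y) = \<Phi> x + \<Phi> y"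
  using Phi_diff[of x "- y"] by (simp add: Phi_uminus minus_add_uminus_mat[of _ N N])

context
  assumes f_add: "\<And>g h. g \<in> carrier (free_grp l) \<Longrightarrow> h \<in> carrier (free_grp l) \<Longrightarrow>
      f (pres_class l rs (g + h)) = f (pres_class l rs g) + f (pres_class l rs h)"
    and \<sigma>_mult: "\<And>g h. g \<in> carrier (free_grp l) \<Longrightarrow> h \<in> carrier (free_grp l) \<Longrightarrow>
      \<sigma> (pres_class l rs (g + h)) = \<sigma> (pres_class l rs g) * \<sigma> (pres_class l rs h)"
    and \<sigma>_carrier: "\<And>g. g \<in> carrier (free_grp l) \<Longrightarrow> \<sigma> (pres_class l rs g) \<in> carrier_mat N N"
begin

lemma Phi_elt_mult:
  assumes g: "g \<in> carrier (free_grp l)" and h: "h \<in> carrier (free_grp l)"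
  shows "\<Phi> (elt (g + h)) = \<Phi> (elt g) * \<Phi> (elt h)"
proof (rule eq_matI)
  fix p q assume "p < dim_row (\<Phi> (elt g) * \<Phi> (elt h))" "q < dim_col (\<Phi> (elt g) * \<Phi> (elt h))"
  then have pq: "p < N" "q < N"
    by simp_all
  have gh: "g + h \<in> carrier (free_grp l)"
    using assms by simp
  show "\<Phi> (elt (g + h)) $$ (p, q) = (\<Phi> (elt g) * \<Phi> (elt h)) $$ (p, q)"
    using pq assms \<sigma>_carrier[OF g] \<sigma>_carrier[OF h]
    by (simp add: Phi_elt Phi_elt[OF \<sigma>_carrier[OF gh]] f_add \<sigma>_mult scalar_prod_def cst_sum power_int_add sum_distrib_left mult_ac)
qed simp_all

lemma Phi_mult:
  assumes x: "Poly_Mapping.keys x \<subseteq> carrier (free_grp l)" and y: "Poly_Mapping.keys y \<subseteq> carrier (free_grp l)"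
  shows "\<Phi> (x * y) = \<Phi> x * \<Phi> y"
proof -
  \<comment> \<open>Bilinearity in two stages: the left factor is a single group element here and
    becomes general in the second induction.\<close>
  have 1: "\<Phi> (elt g * y) = \<Phi> (elt g) * \<Phi> y" if g: "g \<in> carrier (free_grp l)" for g
    using y
  proof (induction rule: frag_induction)
    case zero
    then show ?case
      by (simp add: Phi_zero right_mult_zero_mat[of _ N N])
  next
    case (one h)
    then show ?case
      using g by (simp add: Phi_elt_mult mult_single)
  next
    case (diff a b)
    then show ?case
      by (simp add: right_diff_distrib Phi_diff mult_minus_distrib_mat[of _ N N _ N])
  qed
  show ?thesis
    using x
  proof (induction rule: frag_induction)
    case zero
    then show ?case
      by (simp add: Phi_zero left_mult_zero_mat[of _ N N])
  next
    case (one g)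
    then show ?case
      by (rule 1)
  next
    case (diff a b)
    then show ?case
      by (simp add: left_diff_distrib Phi_diff minus_mult_distrib_mat[of _ N N _ _ N])
  qed
qed

end

end

section \<open>The twist relator\<close>

lemma twist_w_eq: "twist_w = gen 1 + - gen 0 + - gen 1 + gen 0"
  by (simp add: twist_w_def)

lemma twist_w_in [simp]: "twist_w \<in> carrier (free_grp 2)"
  by (simp add: twist_w_eq)

abbreviation twist_w_pow :: "int \<Rightarrow> nat free_group" where
  "twist_w_pow i \<equiv> twist_w [^]\<^bsub>free_grp 2\<^esub> i"

lemma twist_w_pow_in [simp]: "twist_w_pow i \<in> carrier (free_grp 2)"
  by (rule group.int_pow_closed[OF group_free_grp]) simp

lemma twist_w_pow_add: "twist_w_pow (i + j) = twist_w_pow i + twist_w_pow j"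
  using group.int_pow_mult[OF group_free_grp twist_w_in, of i j] by simp

lemma twist_w_pow_1: "twist_w_pow 1 = twist_w"
  by (rule group.int_pow_1[OF group_free_grp]) simp

lemma twist_w_pow_diff: "twist_w_pow (i - 1) = twist_w_pow i + - twist_w"
  using twist_w_pow_add[of "i - 1" 1] by (simp add: twist_w_pow_1 add.assoc)

lemma twist_relator_eq: "twist_relator n = (twist_w_pow n + gen 0) + - (gen 1 + twist_w_pow n)"
  unfolding twist_relator_def by simp

lemma twist_relator_in [simp]: "twist_relator n \<in> carrier (free_grp 2)"
  unfolding twist_relator_eq by simp

lemma fox_twist_w: "fox 1 twist_w = 1 - elt (gen 1 + - gen 0 + - gen 1)"
  unfolding twist_w_eq fox_mult fox_uminus fox_gen by (simp add: mult_single)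

lemma fox_twist_w_pow: "fox j (twist_w_pow (i + 1)) = fox j (twist_w_pow i) + elt (twist_w_pow i) * fox j twist_w"
  by (simp only: twist_w_pow_add twist_w_pow_1 fox_mult)

lemma fox_twist_relator:
  "fox 1 (twist_relator n) = fox 1 (twist_w_pow n)
    - elt (twist_relator n) * (1 + elt (gen 1) * fox 1 (twist_w_pow n))"
proof -
  have "elt (twist_relator n) = elt (twist_w_pow n + gen 0) * elt (- (gen 1 + twist_w_pow n))"
    by (simp add: twist_relator_eq mult_single)
  then show ?thesis
    unfolding twist_relator_eq by (simp only: fox_mult fox_uminus fox_gen) (simp add: algebra_simps)
qed

text \<open>The adjoint matrix in one fixed basis of sl2, polynomial in the entries so that no
  inverse appears. \<open>Ad_mat_conjugate\<close> links it to an arbitrary basis.\<close>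

definition adm :: "'a::comm_ring_1 mat \<Rightarrow> 'a mat" where
  "adm A = ad3 (A $$ (0, 0)) (A $$ (0, Suc 0)) (A $$ (Suc 0, 0)) (A $$ (Suc 0, Suc 0))"

lemma adm_mat2 [simp]: "adm (mat2 a b c d) = ad3 a b c d"
  by (simp add: adm_def)

lemma adm_carrier [simp]: "adm A \<in> carrier_mat 3 3"
  by (simp add: adm_def)

lemma adm_mult: "A \<in> carrier_mat 2 2 \<Longrightarrow> B \<in> carrier_mat 2 2 \<Longrightarrow> adm (A * B) = adm A * adm B"
  by (elim mat2_cases) (simp add: mat2_arith ad3_mult)

lemma adm_one: "adm (1\<^sub>m 2) = 1\<^sub>m 3"
  by (simp add: mat2_one ad3_one)

lemma poly3_comm3_add:
  "poly3 (comm3 a b c d) n p r + poly3 (comm3 a b c d) n' p' r' = poly3 (comm3 a b c d) (n + n') (p + p') (r + r')"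
  by (simp add: poly3_def comm3_def mat3_arith mat3_one algebra_simps)

lemma mat_add_right_cancel:
  fixes A :: "'a::group_add mat"
  assumes "A + C = B + C" "A \<in> carrier_mat n m" "B \<in> carrier_mat n m" "C \<in> carrier_mat n m"
  shows "A = B"
proof (rule eq_matI)
  fix i j assume "i < dim_row B" "j < dim_col B"
  then show "A $$ (i, j) = B $$ (i, j)"
    using arg_cong[OF assms(1), of "\<lambda>M. M $$ (i, j)"] assms(2-4) by simp
qed (use assms in auto)

lemma map_mat_cst_add:
  "A \<in> carrier_mat n m \<Longrightarrow> B \<in> carrier_mat n m \<Longrightarrow> map_mat cst (A + B) = map_mat cst A + map_mat cst B"
  by (rule eq_matI) auto

lemma map_mat_cst_mult:
  "A \<in> carrier_mat n m \<Longrightarrow> B \<in> carrier_mat m k \<Longrightarrow> map_mat cst (A * B) = map_mat cst A * map_mat cst B"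
  by (rule eq_matI) (auto simp: scalar_prod_def cst_sum)

lemma one_smult_mat [simp]: "1 \<cdot>\<^sub>m A = (A :: 'a::semiring_1 mat)"
  by (rule eq_matI) auto

lemma map_mat_cst_one: "map_mat cst (1\<^sub>m n) = 1\<^sub>m n"
  by (rule eq_matI) auto

text \<open>By W^2 = z W - 1 and W^-1 = z - W, multiplying S W - S' by W or W^-1 changes the pair
  (S, S') into (z S - S', S) or (S', z S' - S). This is the Chebyshev recursion for the powers of
  W.\<close>

lemma mat2_mult_cayley_hamilton:
  fixes a :: "'a::idom"
  assumes "a * d - b * c = 1"
  shows "mat2 (S * a - S') (S * b) (S * c) (S * d - S') * mat2 a b c d =
      mat2 (((a + d) * S - S') * a - S) (((a + d) * S - S') * b) (((a + d) * S - S') * c) (((a + d) * S - S') * d - S)"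
    and "mat2 (S * a - S') (S * b) (S * c) (S * d - S') * mat2 d (- b) (- c) a =
      mat2 (S' * a - ((a + d) * S' - S)) (S' * b) (S' * c) (S' * d - ((a + d) * S' - S))"
  using assms unfolding mat2_arith mat2_eq_iff
  by (simp_all add: algebra_simps)

section \<open>Images of the Fox derivatives of the powers of w and of the relator\<close>

text \<open>Only behaviour on classes of words is required, so the given representation and its
  conjugate in normal form are both instances.\<close>

locale fox_rep =
  fixes rs :: "nat free_group list" and f :: "nat free_group set \<Rightarrow> int"
    and \<rho> :: "nat free_group set \<Rightarrow> complex mat"
  assumes f_add: "\<And>g h. g \<in> carrier (free_grp 2) \<Longrightarrow> h \<in> carrier (free_grp 2) \<Longrightarrow>
      f (pres_class 2 rs (g + h)) = f (pres_class 2 rs g) + f (pres_class 2 rs h)"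
    and \<rho>_mult: "\<And>g h. g \<in> carrier (free_grp 2) \<Longrightarrow> h \<in> carrier (free_grp 2) \<Longrightarrow>
      \<rho> (pres_class 2 rs (g + h)) = \<rho> (pres_class 2 rs g) * \<rho> (pres_class 2 rs h)"
    and \<rho>_carrier: "\<And>g. g \<in> carrier (free_grp 2) \<Longrightarrow> \<rho> (pres_class 2 rs g) \<in> carrier_mat 2 2"
    and \<rho>_zero: "\<rho> (pres_class 2 rs 0) = 1\<^sub>m 2"
begin

lemma f_uminus: "g \<in> carrier (free_grp 2) \<Longrightarrow> f (pres_class 2 rs (- g)) = - f (pres_class 2 rs g)"
  using f_add[of 0 0] f_add[of g "- g"] by simp

lemma adm_hom:
  assumes "g \<in> carrier (free_grp 2)" "h \<in> carrier (free_grp 2)"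
  shows "(adm \<circ> \<rho>) (pres_class 2 rs (g + h)) = (adm \<circ> \<rho>) (pres_class 2 rs g) * (adm \<circ> \<rho>) (pres_class 2 rs h)"
  using assms by (simp add: \<rho>_mult adm_mult \<rho>_carrier)

abbreviation "\<Psi> \<equiv> Phi 2 rs 3 f (adm \<circ> \<rho>)"

lemma Psi_elt: "\<Psi> (elt g) = tvar powi f (pres_class 2 rs g) \<cdot>\<^sub>m map_mat cst (adm (\<rho> (pres_class 2 rs g)))"
  by (simp add: Phi_elt)

lemma Psi_mult:
  "Poly_Mapping.keys x \<subseteq> carrier (free_grp 2) \<Longrightarrow> Poly_Mapping.keys y \<subseteq> carrier (free_grp 2) \<Longrightarrow>
    \<Psi> (x * y) = \<Psi> x * \<Psi> y"
  by (rule Phi_mult) (simp_all only: f_add adm_hom, simp)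

lemma \<rho>_uminus:
  assumes "g \<in> carrier (free_grp 2)" and g: "\<rho> (pres_class 2 rs g) = mat2 a b c d" and det: "a * d - b * c = 1"
  shows "\<rho> (pres_class 2 rs (- g)) = mat2 d (- b) (- c) a"
proof -
  have X: "\<rho> (pres_class 2 rs (- g)) \<in> carrier_mat 2 2"
    using assms(1) by (intro \<rho>_carrier) simp
  have one: "mat2 a b c d * mat2 d (- b) (- c) a = 1\<^sub>m 2"
    using det by (simp add: mat2_arith mat2_one algebra_simps)
  have "\<rho> (pres_class 2 rs (- g)) * mat2 a b c d = 1\<^sub>m 2"
    using \<rho>_mult[of "- g" g] assms(1) by (simp add: \<rho>_zero g)
  then have "\<rho> (pres_class 2 rs (- g)) * mat2 a b c d * mat2 d (- b) (- c) a = mat2 d (- b) (- c) a"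
    by (simp add: left_mult_one_mat[of _ 2 2])
  then show ?thesis
    using X by (simp add: assoc_mult_mat[OF X mat2_carrier mat2_carrier] one right_mult_one_mat[OF X])
qed

context
  fixes a b c d z :: complex
  assumes W: "\<rho> (pres_class 2 rs twist_w) = mat2 a b c d" and det: "a * d - b * c = 1"
    and f_w: "f (pres_class 2 rs twist_w) = 0" and z: "z = a + d"
begin

lemma Psi_fox_twist_w_pow_add:
  assumes "f (pres_class 2 rs (twist_w_pow i)) = 0"
    and "\<rho> (pres_class 2 rs (twist_w_pow i)) = mat2 (S * a - S') (S * b) (S * c) (S * d - S')"
    and "S\<^sup>2 + S'\<^sup>2 - z * S * S' = 1"
  shows "\<Psi> (fox 1 (twist_w_pow (i + 1))) = \<Psi> (fox 1 (twist_w_pow i)) +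
    map_mat cst (poly3 (comm3 a b c d) 1 (S\<^sup>2 * z / 2 - S * S') (S\<^sup>2 / 2)) * \<Psi> (fox 1 twist_w)"
proof -
  have "adm (\<rho> (pres_class 2 rs (twist_w_pow i))) =
      poly3 (comm3 a b c d) 1 (S\<^sup>2 * z / 2 - S * S') (S\<^sup>2 / 2)"
    using ad3_eq_poly3[OF _ det, of "1 / 2" S S'] assms(3) by (simp add: assms(2) z)
  then have "\<Psi> (elt (twist_w_pow i)) = map_mat cst (poly3 (comm3 a b c d) 1 (S\<^sup>2 * z / 2 - S * S') (S\<^sup>2 / 2))"
    by (simp add: Psi_elt assms(1))
  moreover have "\<Psi> (elt (twist_w_pow i) * fox 1 twist_w) = \<Psi> (elt (twist_w_pow i)) * \<Psi> (fox 1 twist_w)"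
    by (rule Psi_mult) (simp_all add: keys_fox)
  ultimately show ?thesis
    by (simp only: fox_twist_w_pow Phi_add)
qed

text \<open>Each step adds or subtracts one Ad(W^i), a quadratic polynomial in \<kappa>. The
  \<kappa>^2 coefficient \<open>r\<close> stays existential: the stated value of
  \<open>r * (z\<^sup>2 - 4)\<close> is enough later and involves no division by a quantity that may
  vanish.\<close>

lemma Psi_fox_twist_w_pow:
  "\<exists>S S' r. f (pres_class 2 rs (twist_w_pow i)) = 0 \<and>
    \<rho> (pres_class 2 rs (twist_w_pow i)) = mat2 (S * a - S') (S * b) (S * c) (S * d - S') \<and>
    S\<^sup>2 + S'\<^sup>2 - z * S * S' = 1 \<and>
    of_int i + r * (z\<^sup>2 - 4) = S\<^sup>2 - z * S * S' / 2 \<and>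
    \<Psi> (fox 1 (twist_w_pow i)) =
      map_mat cst (poly3 (comm3 a b c d) (of_int i) (S * S' / 2) r) * \<Psi> (fox 1 twist_w)"
    (is "\<exists>S S' r. ?P i S S' r")
proof (induction i rule: int_induct[where k = 0])
  case base
  have "poly3 (comm3 a b c d) 0 0 0 = 0\<^sub>m 3 3"
    by (simp add: poly3_def comm3_def mat3_arith mat3_one) (rule mat3_eqI[symmetric], simp_all)
  moreover have "map_mat cst (0\<^sub>m 3 3) = 0\<^sub>m 3 3"
    by (rule eq_matI) simp_all
  \<comment> \<open>W^0 = 0 W - (-1), hence S = 0 and S' = -1.\<close>
  ultimately have "?P 0 0 (- 1) 0"
    using f_add[of 0 0] by (simp add: \<rho>_zero mat2_one Phi_zero left_mult_zero_mat[of _ 3 3])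
  then show ?case by blast
next
  case (step1 i)
  then obtain S S' r where IH: "?P i S S' r" by blast
  then have IH_det: "S\<^sup>2 + S'\<^sup>2 - z * S * S' = 1"
    and IH_r: "of_int i + r * (z\<^sup>2 - 4) = S\<^sup>2 - z * S * S' / 2"
    by simp_all
  have "\<rho> (pres_class 2 rs (twist_w_pow (i + 1))) =
      mat2 (S * a - S') (S * b) (S * c) (S * d - S') * mat2 a b c d"
    using IH by (simp add: twist_w_pow_add twist_w_pow_1 \<rho>_mult W)
  also have "\<dots> = mat2 ((z * S - S') * a - S) ((z * S - S') * b) ((z * S - S') * c) ((z * S - S') * d - S)"
    unfolding z by (rule mat2_mult_cayley_hamilton(1)[OF det])
  finally have 1: "\<rho> (pres_class 2 rs (twist_w_pow (i + 1))) = \<dots>" .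
  have 2: "\<Psi> (fox 1 (twist_w_pow (i + 1))) =
      map_mat cst (poly3 (comm3 a b c d) (of_int (i + 1)) ((z * S - S') * S / 2) (r + S\<^sup>2 / 2)) * \<Psi> (fox 1 twist_w)"
  proof -
    let ?A = "poly3 (comm3 a b c d) (of_int i) (S * S' / 2) r"
    let ?B = "poly3 (comm3 a b c d) 1 (S\<^sup>2 * z / 2 - S * S') (S\<^sup>2 / 2)"
    have "\<Psi> (fox 1 (twist_w_pow (i + 1))) = map_mat cst ?A * \<Psi> (fox 1 twist_w) + map_mat cst ?B * \<Psi> (fox 1 twist_w)"
      using IH Psi_fox_twist_w_pow_add by metis
    also have "\<dots> = map_mat cst (?A + ?B) * \<Psi> (fox 1 twist_w)"
      by (simp add: map_mat_cst_add[of _ 3 3] add_mult_distrib_mat[of _ 3 3 _ _ 3])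
    also have "?A + ?B = poly3 (comm3 a b c d) (of_int (i + 1)) ((z * S - S') * S / 2) (r + S\<^sup>2 / 2)"
      unfolding poly3_comm3_add by (simp add: field_simps power2_eq_square)
    finally show ?thesis .
  qed
  have 0: "f (pres_class 2 rs (twist_w_pow (i + 1))) = 0"
    using IH by (simp add: twist_w_pow_add twist_w_pow_1 f_add f_w)
  have 3: "(z * S - S')\<^sup>2 + S\<^sup>2 - z * (z * S - S') * S = 1"
    using IH_det by (simp add: algebra_simps power2_eq_square)
  \<comment> \<open>The increment 1 of the exponent is replaced by
    \<open>S\<^sup>2 + S'\<^sup>2 - z * S * S'\<close>, the determinant of W^i.\<close>
  have 4: "of_int (i + 1) + (r + S\<^sup>2 / 2) * (z\<^sup>2 - 4) = (z * S - S')\<^sup>2 - z * (z * S - S') * S / 2"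
  proof -
    have "of_int (i + 1) + (r + S\<^sup>2 / 2) * (z\<^sup>2 - 4) = of_int i + r * (z\<^sup>2 - 4) + 1 + S\<^sup>2 / 2 * (z\<^sup>2 - 4)"
      by (simp add: algebra_simps)
    also have "\<dots> = (S\<^sup>2 - z * S * S' / 2) + (S\<^sup>2 + S'\<^sup>2 - z * S * S') + S\<^sup>2 / 2 * (z\<^sup>2 - 4)"
      unfolding IH_r IH_det ..
    also have "\<dots> = (z * S - S')\<^sup>2 - z * (z * S - S') * S / 2"
      by (simp add: field_simps power2_eq_square)
    finally show ?thesis .
  qed
  have "?P (i + 1) (z * S - S') S (r + S\<^sup>2 / 2)"
    using 0 1 2 3 4 by blast
  then show ?case by blast
next
  case (step2 i)
  then obtain S S' r where IH: "?P i S S' r" by blast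
  then have IH_det: "S\<^sup>2 + S'\<^sup>2 - z * S * S' = 1"
    and IH_r: "of_int i + r * (z\<^sup>2 - 4) = S\<^sup>2 - z * S * S' / 2"
    by simp_all
  have inv: "\<rho> (pres_class 2 rs (- twist_w)) = mat2 d (- b) (- c) a"
    by (rule \<rho>_uminus[OF _ W det]) simp
  have "\<rho> (pres_class 2 rs (twist_w_pow (i - 1))) =
      mat2 (S * a - S') (S * b) (S * c) (S * d - S') * mat2 d (- b) (- c) a"
    unfolding twist_w_pow_diff using IH by (simp add: \<rho>_mult inv del: add_uminus_conv_diff)
  also have "\<dots> = mat2 (S' * a - (z * S' - S)) (S' * b) (S' * c) (S' * d - (z * S' - S))"
    unfolding z by (rule mat2_mult_cayley_hamilton(2)[OF det])
  finally have 1: "\<rho> (pres_class 2 rs (twist_w_pow (i - 1))) = \<dots>" .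
  have 0: "f (pres_class 2 rs (twist_w_pow (i - 1))) = 0"
    unfolding twist_w_pow_diff using IH by (simp add: f_add f_uminus f_w del: add_uminus_conv_diff)
  have 3: "S'\<^sup>2 + (z * S' - S)\<^sup>2 - z * S' * (z * S' - S) = 1"
    using IH_det by (simp add: algebra_simps power2_eq_square)
  have 2: "\<Psi> (fox 1 (twist_w_pow (i - 1))) =
      map_mat cst (poly3 (comm3 a b c d) (of_int (i - 1)) (S' * (z * S' - S) / 2) (r - S'\<^sup>2 / 2)) * \<Psi> (fox 1 twist_w)"
  proof -
    let ?A = "poly3 (comm3 a b c d) (of_int i) (S * S' / 2) r"
    let ?B = "poly3 (comm3 a b c d) 1 (S'\<^sup>2 * z / 2 - S' * (z * S' - S)) (S'\<^sup>2 / 2)"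
    let ?C = "poly3 (comm3 a b c d) (of_int (i - 1)) (S' * (z * S' - S) / 2) (r - S'\<^sup>2 / 2)"
    \<comment> \<open>Downwards, the recursion is read from \<open>i - 1\<close> to
      \<open>i\<close>, and the common summand is cancelled.\<close>
    have "\<Psi> (fox 1 (twist_w_pow i)) = \<Psi> (fox 1 (twist_w_pow (i - 1))) + map_mat cst ?B * \<Psi> (fox 1 twist_w)"
      using Psi_fox_twist_w_pow_add[OF 0 1 3] by simp
    moreover have "\<Psi> (fox 1 (twist_w_pow i)) = map_mat cst ?A * \<Psi> (fox 1 twist_w)"
      using IH by blast
    moreover have "?A = ?C + ?B"
      unfolding poly3_comm3_add by (simp add: field_simps power2_eq_square)
    moreover have "map_mat cst (?C + ?B) * \<Psi> (fox 1 twist_w) =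
        map_mat cst ?C * \<Psi> (fox 1 twist_w) + map_mat cst ?B * \<Psi> (fox 1 twist_w)"
      by (simp add: map_mat_cst_add[of _ 3 3] add_mult_distrib_mat[of _ 3 3 _ _ 3])
    ultimately have "map_mat cst ?C * \<Psi> (fox 1 twist_w) + map_mat cst ?B * \<Psi> (fox 1 twist_w) =
        \<Psi> (fox 1 (twist_w_pow (i - 1))) + map_mat cst ?B * \<Psi> (fox 1 twist_w)"
      by simp
    then have "map_mat cst ?C * \<Psi> (fox 1 twist_w) = \<Psi> (fox 1 (twist_w_pow (i - 1)))"
      by (rule mat_add_right_cancel[where n = 3 and m = 3]) (simp_all add: mult_carrier_mat[of _ 3 3])
    then show ?thesis ..
  qed
  have 4: "of_int (i - 1) + (r - S'\<^sup>2 / 2) * (z\<^sup>2 - 4) = S'\<^sup>2 - z * S' * (z * S' - S) / 2"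
  proof -
    have "of_int (i - 1) + (r - S'\<^sup>2 / 2) * (z\<^sup>2 - 4) = of_int i + r * (z\<^sup>2 - 4) - 1 - S'\<^sup>2 / 2 * (z\<^sup>2 - 4)"
      by (simp add: algebra_simps)
    also have "\<dots> = (S\<^sup>2 - z * S * S' / 2) - (S\<^sup>2 + S'\<^sup>2 - z * S * S') - S'\<^sup>2 / 2 * (z\<^sup>2 - 4)"
      unfolding IH_r IH_det ..
    also have "\<dots> = S'\<^sup>2 - z * S' * (z * S' - S) / 2"
      by (simp add: field_simps power2_eq_square)
    finally show ?thesis .
  qed
  have "?P (i - 1) S' (z * S' - S) (r - S'\<^sup>2 / 2)"
    using 0 1 2 3 4 by blast
  then show ?case by blast
qed

end

lemma Psi_one: "\<Psi> 1 = 1\<^sub>m 3"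
  using Psi_elt[of 0] f_add[of 0 0] by (simp add: \<rho>_zero adm_one map_mat_cst_one)

lemma Psi_fox_twist_relator:
  assumes "\<Psi> (elt (twist_relator n)) = 1\<^sub>m 3"
  shows "\<Psi> (fox 1 (twist_relator n)) = (1\<^sub>m 3 - \<Psi> (elt (gen 1))) * \<Psi> (fox 1 (twist_w_pow n)) - 1\<^sub>m 3"
proof -
  let ?F = "fox 1 (twist_w_pow n)" and ?C = "carrier (free_grp 2)"
  have keys: "Poly_Mapping.keys ?F \<subseteq> ?C" "Poly_Mapping.keys (elt (gen 1)) \<subseteq> ?C"
      "Poly_Mapping.keys (elt (twist_relator n)) \<subseteq> ?C"
    by (simp_all add: keys_fox)
  have "fox 1 (twist_relator n) = ?F - elt (twist_relator n) * (elt (gen 1) * ?F) - elt (twist_relator n)"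
    unfolding fox_twist_relator by (simp add: algebra_simps)
  moreover have "Poly_Mapping.keys (elt (gen 1) * ?F) \<subseteq> ?C"
    using keys_mult[of "elt (gen 1)" ?F] keys(1) by (fastforce dest!: subsetD)
  ultimately have "\<Psi> (fox 1 (twist_relator n)) = \<Psi> ?F - \<Psi> (elt (gen 1)) * \<Psi> ?F - 1\<^sub>m 3"
    using keys assms by (simp add: Phi_diff Psi_mult left_mult_one_mat[of _ 3 3] mult_carrier_mat[of _ 3 3])
  then show ?thesis
    by (simp add: minus_mult_distrib_mat[of _ 3 3 _ _ 3] left_mult_one_mat[of _ 3 3])
qed

text \<open>The fundamental formula makes the two products opposite matrices; the minus sign
  survives as (-1)^3 because the matrices have size 3.\<close>

lemma Psi_fox_fundamental:
  assumes "\<Psi> (elt r) = 1\<^sub>m 3" "r \<in> carrier (free_grp 2)"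
  shows "det (\<Psi> (fox 0 r)) * det (\<Psi> (1 - elt (gen 0))) = - det (\<Psi> (fox 1 r)) * det (\<Psi> (1 - elt (gen 1)))"
proof -
  let ?C = "carrier (free_grp 2)"
  have keys: "Poly_Mapping.keys (1 - elt (gen j)) \<subseteq> ?C" if "j < 2" for j
    using keys_diff[of 1 "elt (gen j)"] that by auto
  have "fox 0 r * (1 - elt (gen 0)) = (1 - elt r) - fox 1 r * (1 - elt (gen 1))"
    using fox_fundamental[OF assms(2)] by (simp add: numeral_2_eq_2 algebra_simps)
  then have "\<Psi> (fox 0 r) * \<Psi> (1 - elt (gen 0)) = \<Psi> (1 - elt r) - \<Psi> (fox 1 r) * \<Psi> (1 - elt (gen 1))"
    using keys assms(2) by (simp add: keys_fox flip: Psi_mult Phi_diff)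
  also have "\<Psi> (1 - elt r) = 0\<^sub>m 3 3"
    by (simp only: Phi_diff Psi_one assms(1)) (rule minus_r_inv_mat, simp)
  also have "0\<^sub>m 3 3 - \<Psi> (fox 1 r) * \<Psi> (1 - elt (gen 1)) = (-1) \<cdot>\<^sub>m (\<Psi> (fox 1 r) * \<Psi> (1 - elt (gen 1)))"
    by (rule eq_matI) simp_all
  finally have "det (\<Psi> (fox 0 r) * \<Psi> (1 - elt (gen 0))) = det ((-1) \<cdot>\<^sub>m (\<Psi> (fox 1 r) * \<Psi> (1 - elt (gen 1))))"
    by (simp only:)
  then show ?thesis
    by (simp add: det_mult[of _ 3])
qed

end

section \<open>Evaluation of both quotients for a pair in normal form\<close>

lemma one_minus_tvar_nonzero: "1 - tvar \<noteq> 0"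
proof -
  have "1 - tvar = to_fract [:1, - 1:]"
    by (simp add: tvar_def one_pCons flip: to_fract_1 to_fract_diff)
  then show ?thesis
    by simp
qed

lemma quadratic_tvar_nonzero: "1 - cst c * tvar + tvar\<^sup>2 \<noteq> 0"
proof -
  have "1 - cst c * tvar + tvar\<^sup>2 = to_fract [:1, - c, 1:]"
    by (simp add: tvar_def cst_def one_pCons power2_eq_square flip: to_fract_1 to_fract_diff to_fract_mult to_fract_add)
  then show ?thesis
    by simp
qed

lemma cst_nonzero_iff [simp]: "cst c = 0 \<longleftrightarrow> c = 0"
  by (simp add: cst_def)

lemma cst_power [simp]: "cst (c ^ k) = cst c ^ k"
  by (induction k) simp_all

lemma cst_of_int [simp]: "cst (of_int i) = of_int i"
proof -
  have "cst (of_nat k) = of_nat k" for k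
    by (induction k) simp_all
  then show ?thesis
    by (cases i rule: int_cases2) simp_all
qed

lemma cst_numeral [simp]: "cst (numeral k) = numeral k"
  using cst_of_int[of "numeral k"] by simp

lemma cst_divide [simp]: "cst (a / b) = cst a / cst b"
proof (cases "b = 0")
  case False
  have "cst (a / b) * cst b = cst a"
    using False by (simp flip: cst_simps)
  then show ?thesis
    using False by (simp add: eq_divide_eq)
qed simp

lemma map_mat_cst_ad3: "map_mat cst (ad3 a b c d) = ad3 (cst a) (cst b) (cst c) (cst d)"
  by (simp add: ad3_def map_mat3)

lemma map_mat_cst_poly3_comm3:
  "map_mat cst (poly3 (comm3 a b c d) n p r) = poly3 (comm3 (cst a) (cst b) (cst c) (cst d)) (cst n) (cst p) (cst r)"
  by (simp add: poly3_def comm3_def mat3_one mat3_arith map_mat3)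

lemma riley_w:
  fixes m :: "'a::field"
  assumes "m * mi = 1"
  shows "mat2 m 0 (q * m) mi * mat2 mi (- mi) 0 m * mat2 mi 0 (- (q * m)) m * mat2 m mi 0 mi =
    mat2 (1 + q * m\<^sup>2) (mi\<^sup>2 - (1 - q)) (q - q * m\<^sup>2 * (1 - q)) (q * mi\<^sup>2 + (1 - q)\<^sup>2)"
  unfolding mat2_arith mat2_eq_iff using assms by (intro conjI; Groebner_Basis.algebra)

lemma riley_w_trace_det:
  fixes m :: "'a::field"
  assumes "m * mi = 1" "x = m + mi" "y = 2 - q"
  shows "2 + (y - 2) * (y + 2 - x\<^sup>2) = (1 + q * m\<^sup>2) + (q * mi\<^sup>2 + (1 - q)\<^sup>2)"
    and "(1 + q * m\<^sup>2) * (q * mi\<^sup>2 + (1 - q)\<^sup>2) - (mi\<^sup>2 - (1 - q)) * (q - q * m\<^sup>2 * (1 - q)) = 1"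
  unfolding assms(2,3) using assms(1) by (Groebner_Basis.algebra, Groebner_Basis.algebra)

text \<open>The last hypothesis is the upper right entry of W^n A = B W^n with W^n = S W - S';
  solving it for S' already gives the proportionality.\<close>

lemma riley_relation:
  fixes m :: "'a::field"
  assumes "m * mi = 1" "x = m + mi" "y = 2 - q"
    and "(S * (1 + q * m\<^sup>2) - S') * mi + S * (mi\<^sup>2 - (1 - q)) * mi = m * (S * (mi\<^sup>2 - (1 - q)))"
  shows "S' = (x\<^sup>2 - 1 - y) * S"
  unfolding assms(2,3) using assms(1,4) by Groebner_Basis.algebra

lemma riley_final:
  fixes t ti E :: "'a::field"
  assumes t: "t * ti = 1" and E: "E = (1 - t) * (1 - (X - 2) * t + t\<^sup>2)" "E \<noteq> 0"
    and D: "D * Z = - (s * ((t - 1)\<^sup>2 * (t\<^sup>2 - (X - 2) * t + 1)) * ti ^ 3 * (Z * (n * t\<^sup>2 + n) + C * t))"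
    and Z: "Z \<noteq> 0" and s: "s * V = 1"
  shows "D / E = ti ^ 3 * ((t - 1) / V * (n * t\<^sup>2 + C / Z * t + n))"
proof -
  have V: "V \<noteq> 0"
    using s by auto
  have s': "s = 1 / V"
    using s V by (simp add: eq_divide_eq)
  have "D * Z = E * (ti ^ 3 * (t - 1) * s * (Z * (n * t\<^sup>2 + n) + C * t))"
    unfolding D E(1) by Groebner_Basis.algebra
  also have "\<dots> = E * (ti ^ 3 * ((t - 1) / V * (n * t\<^sup>2 + C / Z * t + n))) * Z"
    unfolding s' using Z V by (simp add: field_simps)
  finally have "D = E * (ti ^ 3 * ((t - 1) / V * (n * t\<^sup>2 + C / Z * t + n)))"
    by (simp only: mult_right_cancel[OF Z])
  then show ?thesis
    using E(2) by simp
qed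

lemma det_one_minus_inverse_tvar_ad3:
  assumes "a * d - b * c = (1 :: complex)"
  shows "det (1\<^sub>m 3 - inverse tvar \<cdot>\<^sub>m ad3 (cst a) (cst b) (cst c) (cst d)) \<noteq> 0"
proof -
  let ?ti = "inverse tvar"
  have ti: "tvar * ?ti = 1"
    by simp
  have "cst a * cst d - cst b * cst c = 1"
    using arg_cong[OF assms, of cst] by simp
  then have det: "det (1\<^sub>m 3 - ?ti \<cdot>\<^sub>m ad3 (cst a) (cst b) (cst c) (cst d)) =
      (1 - ?ti) * (1 - cst ((a + d)\<^sup>2 - 2) * ?ti + ?ti\<^sup>2)"
    by (simp add: det_one_minus_ad3)
  \<comment> \<open>Up to sign and a power of t the polynomial is palindromic, so its value at t^-1
    is nonzero together with its value at t.\<close>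
  have "(1 - ?ti) * (1 - C * ?ti + ?ti\<^sup>2) * tvar ^ 3 = - ((1 - tvar) * (1 - C * tvar + tvar\<^sup>2))" for C
    using ti by Groebner_Basis.algebra
  moreover have "(1 - tvar) * (1 - cst ((a + d)\<^sup>2 - 2) * tvar + tvar\<^sup>2) \<noteq> 0"
    using one_minus_tvar_nonzero quadratic_tvar_nonzero[of "(a + d)\<^sup>2 - 2"] by simp
  ultimately show ?thesis
    unfolding det by (metis mult_zero_left neg_equal_0_iff_equal)
qed

lemma riley_twisted_alexander:
  fixes n :: int and f :: "nat free_group set \<Rightarrow> int" and \<rho> :: "nat free_group set \<Rightarrow> complex mat"
    and m mi q x y :: complex
  defines "rs \<equiv> [twist_relator n]"
  assumes f_add: "\<And>g h. g \<in> carrier (free_grp 2) \<Longrightarrow> h \<in> carrier (free_grp 2) \<Longrightarrow>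
      f (pres_class 2 rs (g + h)) = f (pres_class 2 rs g) + f (pres_class 2 rs h)"
    and \<rho>_mult: "\<And>g h. g \<in> carrier (free_grp 2) \<Longrightarrow> h \<in> carrier (free_grp 2) \<Longrightarrow>
      \<rho> (pres_class 2 rs (g + h)) = \<rho> (pres_class 2 rs g) * \<rho> (pres_class 2 rs h)"
    and \<rho>_carrier: "\<And>g. g \<in> carrier (free_grp 2) \<Longrightarrow> \<rho> (pres_class 2 rs g) \<in> carrier_mat 2 2"
    and \<rho>_zero: "\<rho> (pres_class 2 rs 0) = 1\<^sub>m 2"
    and f_rel: "f (pres_class 2 rs (twist_relator n)) = 0"
    and \<rho>_rel: "\<rho> (pres_class 2 rs (twist_relator n)) = 1\<^sub>m 2"
    and f_gen: "f (pres_class 2 rs (gen 0)) = 1" "f (pres_class 2 rs (gen 1)) = 1"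
    and A: "\<rho> (pres_class 2 rs (gen 0)) = mat2 m mi 0 mi"
    and B: "\<rho> (pres_class 2 rs (gen 1)) = mat2 m 0 (q * m) mi"
    and m: "m * mi = 1" and x: "x = m + mi" and y: "y = 2 - q"
    and n: "n \<noteq> 0" and ne: "y^2 - y * x^2 + 2 * x^2 \<noteq> 0"
    and R: "R = (tvar - 1) / cst ((y + 2 - x^2) * (y^2 - y * x^2 + x^2))
      * (of_int n * tvar^2
         + cst (((2 * of_int n - 1) * y^2 + y * x^2 - 2 * of_int n * x^2 * (x^2 - 2))
                / (y^2 - y * x^2 + 2 * x^2)) * tvar
         + of_int n)"
  shows "(y + 2 - x^2) * (y^2 - y * x^2 + x^2) \<noteq> 0"
    and "det (Phi 2 rs 3 f (adm \<circ> \<rho>) (fox 1 (twist_relator n))) / det (Phi 2 rs 3 f (adm \<circ> \<rho>) (1 - elt (gen 0)))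
      = tvar powi - 3 * R"
    and "det (Phi 2 rs 3 f (adm \<circ> \<rho>) (fox 0 (twist_relator n))) / det (Phi 2 rs 3 f (adm \<circ> \<rho>) (1 - elt (gen 1)))
      = - (tvar powi - 3 * R)"
proof -
  interpret fox_rep rs f \<rho>
    by unfold_locales (fact f_add \<rho>_mult \<rho>_carrier \<rho>_zero)+
  let ?\<Psi> = "Phi 2 rs 3 f (adm \<circ> \<rho>)"
  define wa wb wc wd where "wa = 1 + q * m\<^sup>2" and "wb = mi\<^sup>2 - (1 - q)"
    and "wc = q - q * m\<^sup>2 * (1 - q)" and "wd = q * mi\<^sup>2 + (1 - q)\<^sup>2"
  define k z where "k = x\<^sup>2 - 1 - y" and "z = 2 + (y - 2) * (y + 2 - x\<^sup>2)"
  have det_w: "wa * wd - wb * wc = 1" and z: "z = wa + wd"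
    using riley_w_trace_det[OF m x y] unfolding wa_def wb_def wc_def wd_def z_def by simp_all
  have Ai: "\<rho> (pres_class 2 rs (- gen 0)) = mat2 mi (- mi) 0 m"
    using \<rho>_uminus[OF _ A] m by simp
  have Bi: "\<rho> (pres_class 2 rs (- gen 1)) = mat2 mi 0 (- (q * m)) m"
    using \<rho>_uminus[OF _ B] m by simp
  have G: "\<rho> (pres_class 2 rs (gen 1 + - gen 0 + - gen 1)) =
      mat2 m 0 (q * m) mi * mat2 mi (- mi) 0 m * mat2 mi 0 (- (q * m)) m"
    using Ai B Bi by (simp add: \<rho>_mult del: add_uminus_conv_diff)
  have W: "\<rho> (pres_class 2 rs twist_w) = mat2 wa wb wc wd"
    using G A riley_w[OF m, of q] unfolding wa_def wb_def wc_def wd_def twist_w_eq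
    by (simp add: \<rho>_mult del: add_uminus_conv_diff)
  have f_G: "f (pres_class 2 rs (gen 1 + - gen 0 + - gen 1)) = - 1"
    using f_gen by (simp add: f_add f_uminus del: add_uminus_conv_diff)
  then have f_w: "f (pres_class 2 rs twist_w) = 0"
    using f_gen unfolding twist_w_eq by (simp add: f_add del: add_uminus_conv_diff)
  obtain S S' r where f_wn: "f (pres_class 2 rs (twist_w_pow n)) = 0"
    and Wn: "\<rho> (pres_class 2 rs (twist_w_pow n)) = mat2 (S * wa - S') (S * wb) (S * wc) (S * wd - S')"
    and SS': "S\<^sup>2 + S'\<^sup>2 - z * S * S' = 1" and r: "of_int n + r * (z\<^sup>2 - 4) = S\<^sup>2 - z * S * S' / 2"
    and \<Psi>_wn: "?\<Psi> (fox 1 (twist_w_pow n)) =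
      map_mat cst (poly3 (comm3 wa wb wc wd) (of_int n) (S * S' / 2) r) * ?\<Psi> (fox 1 twist_w)"
    using Psi_fox_twist_w_pow[OF W det_w f_w z, of n] by blast
  have rel: "\<rho> (pres_class 2 rs (twist_w_pow n + gen 0)) = \<rho> (pres_class 2 rs (gen 1 + twist_w_pow n))"
  proof -
    have "twist_w_pow n + gen 0 = twist_relator n + (gen 1 + twist_w_pow n)"
      unfolding twist_relator_eq by (simp only: add.assoc left_minus add_0_right)
    then show ?thesis
      by (simp add: \<rho>_mult[of "twist_relator n"] \<rho>_rel left_mult_one_mat[OF \<rho>_carrier])
  qed
  then have "mat2 (S * wa - S') (S * wb) (S * wc) (S * wd - S') * mat2 m mi 0 mi =
      mat2 m 0 (q * m) mi * mat2 (S * wa - S') (S * wb) (S * wc) (S * wd - S')"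
    by (simp add: \<rho>_mult A B[simplified] Wn)
  then have S': "S' = k * S"
    using riley_relation[OF m x y, of S S'] unfolding mat2_arith wa_def wb_def k_def by simp
  define s where "s = S\<^sup>2"
  have s: "s * (1 + k\<^sup>2 - z * k) = 1"
    using SS' unfolding S' s_def by (simp add: algebra_simps power2_eq_square)
  have uv: "1 + k\<^sup>2 - z * k = (y + 2 - x\<^sup>2) * (y\<^sup>2 - y * x\<^sup>2 + x\<^sup>2)"
    unfolding k_def z_def by (simp add: algebra_simps power2_eq_square)
  have z2: "z + 2 = y^2 - y * x^2 + 2 * x^2"
    unfolding z_def by (simp add: algebra_simps power2_eq_square)
  show "(y + 2 - x^2) * (y^2 - y * x^2 + x^2) \<noteq> 0"
    using s unfolding uv by auto
  let ?m = "cst m" and ?mi = "cst mi" and ?q = "cst q" and ?t = tvar and ?ti = "inverse tvar"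
  let ?G = "ad3 ?m 0 (?q * ?m) ?mi * ad3 ?mi (- ?mi) 0 ?m * ad3 ?mi 0 (- (?q * ?m)) ?m"
  have cm: "?m * ?mi = 1"
    using arg_cong[OF m, of cst] by simp
  have \<Psi>_b: "?\<Psi> (elt (gen 1)) = ?t \<cdot>\<^sub>m ad3 ?m 0 (?q * ?m) ?mi"
    unfolding Psi_elt using f_gen B by (simp add: map_mat_cst_ad3)
  have \<Psi>_a: "?\<Psi> (elt (gen 0)) = ?t \<cdot>\<^sub>m ad3 ?m ?mi 0 ?mi"
    unfolding Psi_elt using f_gen A by (simp add: map_mat_cst_ad3)
  have \<Psi>_w: "?\<Psi> (fox 1 twist_w) = 1\<^sub>m 3 - ?ti \<cdot>\<^sub>m ?G"
    unfolding fox_twist_w Phi_diff Psi_one Psi_elt G f_G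
    by (simp add: mat2_arith ad3_mult map_mat_cst_ad3 power_int_minus)
  have E0: "det (?\<Psi> (1 - elt (gen 0))) = (1 - ?t) * (1 - (cst (x\<^sup>2) - 2) * ?t + ?t\<^sup>2)"
    using det_one_minus_ad3[of ?m ?mi ?mi 0 ?t] cm by (simp add: Phi_diff Psi_one \<Psi>_a x)
  have E1: "det (?\<Psi> (1 - elt (gen 1))) = (1 - ?t) * (1 - (cst (x\<^sup>2) - 2) * ?t + ?t\<^sup>2)"
    using det_one_minus_ad3[of ?m ?mi 0 "?q * ?m" ?t] cm
    by (simp add: Phi_diff Psi_one \<Psi>_b[simplified] x)
  have E: "(1 - ?t) * (1 - (cst (x\<^sup>2) - 2) * ?t + ?t\<^sup>2) \<noteq> 0"
    using one_minus_tvar_nonzero quadratic_tvar_nonzero[of "x\<^sup>2 - 2"] by simp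
  have \<Psi>_r: "?\<Psi> (elt (twist_relator n)) = 1\<^sub>m 3"
    unfolding Psi_elt f_rel \<rho>_rel by (simp add: adm_one map_mat_cst_one)
  have D: "det (?\<Psi> (fox 1 (twist_relator n))) * (cst z + 2) =
    - (cst s * ((?t - 1)\<^sup>2 * (?t\<^sup>2 - ((cst x)\<^sup>2 - 2) * ?t + 1)) * ?ti ^ 3 *
      ((cst z + 2) * (cst (of_int n) * ?t\<^sup>2 + cst (of_int n)) + ((2 * cst (of_int n) - 1) * (cst y)\<^sup>2 +
        cst y * (cst x)\<^sup>2 - 2 * cst (of_int n) * (cst x)\<^sup>2 * ((cst x)\<^sup>2 - 2)) * ?t))"
  proof -
    have \<Psi>_eq: "?\<Psi> (fox 1 (twist_relator n)) =
      (1\<^sub>m 3 - ?t \<cdot>\<^sub>m ad3 ?m 0 (?q * ?m) ?mi) *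
      poly3 (comm3 (cst wa) (cst wb) (cst wc) (cst wd)) (cst (of_int n)) (cst (S * S' / 2)) (cst r) *
      (1\<^sub>m 3 - ?ti \<cdot>\<^sub>m ?G) - 1\<^sub>m 3"
      unfolding Psi_fox_twist_relator[OF \<Psi>_r] \<Psi>_wn \<Psi>_w \<Psi>_b map_mat_cst_poly3_comm3
      by (subst assoc_mult_mat[of _ 3 3 _ 3 _ 3]) (simp_all add: minus_carrier_mat ad3_mult)
    have Y: "det (1\<^sub>m 3 - ?ti \<cdot>\<^sub>m ?G) \<noteq> 0"
    proof -
      obtain a b c d where abcd: "mat2 m 0 (q * m) mi * mat2 mi (- mi) 0 m * mat2 mi 0 (- (q * m)) m = mat2 a b c d"
        by (rule mat2_cases[of "mat2 m 0 (q * m) mi * mat2 mi (- mi) 0 m * mat2 mi 0 (- (q * m)) m"])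
          (simp_all add: mat2_arith)
      have "det (mat2 m 0 (q * m) mi * mat2 mi (- mi) 0 m * mat2 mi 0 (- (q * m)) m) = 1"
        using m by (simp add: det_mult[of _ 2] det_mat2 mult_carrier_mat[of _ 2 2] mult.commute[of mi m])
      then have "a * d - b * c = 1"
        unfolding abcd det_mat2 .
      moreover have "?G = ad3 (cst a) (cst b) (cst c) (cst d)"
        using abcd by (simp add: mat2_arith ad3_mult) (metis cst_simps)
      ultimately show ?thesis
        using det_one_minus_inverse_tvar_ad3 by simp
    qed
    have t: "?t * ?ti = 1"
      by simp
    have "cst 2 * cst (1 / 2) = cst 1"
      by (simp del: cst_numeral cst_divide cst_simps(2) cst_simps(6) flip: cst_simps(6))
    then have h: "2 * cst (1 / 2) = 1"
      by (simp del: cst_divide)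
    have n': "cst (of_int n) \<noteq> 0"
      using n by (simp del: cst_of_int)
    have xyk: "cst x = ?m + ?mi" "cst y = 2 - ?q" "cst k = (cst x)\<^sup>2 - 1 - cst y"
      "cst z = 2 + (cst y - 2) * (cst y + 2 - (cst x)\<^sup>2)"
      by (simp_all add: x y k_def z_def)
    have s': "cst s * (1 + (cst k)\<^sup>2 - cst z * cst k) = 1"
      using arg_cong[OF s, of cst] by simp
    have p: "cst (S * S' / 2) = cst (1 / 2) * cst k * cst s"
      unfolding S' s_def by (simp add: power2_eq_square)
    have r': "cst (of_int n) + cst r * ((cst z)\<^sup>2 - 4) = cst s * (1 - cst (1 / 2) * cst z * cst k)"
    proof -
      have "of_int n + r * (z\<^sup>2 - 4) = s * (1 - 1 / 2 * z * k)"
        unfolding r S' s_def by (simp add: algebra_simps power2_eq_square)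
      from arg_cong[OF this, of cst] show ?thesis
        by simp
    qed
    have W': "mat2 ?m 0 (?q * ?m) ?mi * mat2 ?mi (- ?mi) 0 ?m * mat2 ?mi 0 (- (?q * ?m)) ?m * mat2 ?m ?mi 0 ?mi =
        mat2 (cst wa) (cst wb) (cst wc) (cst wd)"
      unfolding riley_w[OF cm] by (simp add: wa_def wb_def wc_def wd_def)
    show ?thesis
      unfolding \<Psi>_eq by (rule riley_det[OF cm t h n' xyk s' p r' W' HOL.refl Y])
  qed
  have "z + 2 \<noteq> 0"
    using ne unfolding z2 .
  then have Z: "cst z + 2 \<noteq> 0"
    using cst_nonzero_iff[of "z + 2"] by (simp del: cst_nonzero_iff)
  have t: "?t * ?ti = 1"
    by simp
  have V: "cst s * cst ((y + 2 - x\<^sup>2) * (y\<^sup>2 - y * x\<^sup>2 + x\<^sup>2)) = 1"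
    using arg_cong[OF s, of cst] unfolding uv by simp
  have "det (?\<Psi> (fox 1 (twist_relator n))) / ((1 - ?t) * (1 - (cst (x\<^sup>2) - 2) * ?t + ?t\<^sup>2)) = ?ti ^ 3 * R"
    using riley_final[OF t HOL.refl E[unfolded cst_power] D Z V]
    unfolding R z2[symmetric] by simp
  moreover have "?ti ^ 3 = tvar powi - 3"
    by (simp add: power_int_minus power_inverse)
  ultimately have *: "det (?\<Psi> (fox 1 (twist_relator n))) / ((1 - ?t) * (1 - (cst (x\<^sup>2) - 2) * ?t + ?t\<^sup>2)) =
      tvar powi - 3 * R"
    by simp
  then show "det (?\<Psi> (fox 1 (twist_relator n))) / det (?\<Psi> (1 - elt (gen 0))) = tvar powi - 3 * R"
    unfolding E0 .
  \<comment> \<open>Both denominators agree because A and B have equal trace, so the fundamental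
    formula leaves a mere sign between the numerators.\<close>
  have "det (?\<Psi> (fox 0 (twist_relator n))) = - det (?\<Psi> (fox 1 (twist_relator n)))"
    using Psi_fox_fundamental[OF \<Psi>_r twist_relator_in] unfolding E0 E1 mult_right_cancel[OF E] .
  then show "det (?\<Psi> (fox 0 (twist_relator n))) / det (?\<Psi> (1 - elt (gen 1))) = - (tvar powi - 3 * R)"
    unfolding E1 *[symmetric] by simp
qed

section \<open>Normal form of a nonabelian pair\<close>

text \<open>The vector (b, \<mu> - a) is an eigenvector unless it vanishes; then (\<mu> - d, c)
  serves, and if that vanishes too the matrix is scalar.\<close>

lemma eigenvector_2:
  fixes a :: "'a::field"
  assumes "a * d - b * c = 1" "\<mu>\<^sup>2 - (a + d) * \<mu> + 1 = 0"
  obtains u v where "u \<noteq> 0 \<or> v \<noteq> 0" "a * u + b * v = \<mu> * u" "c * u + d * v = \<mu> * v"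
proof -
  have det: "(\<mu> - a) * (\<mu> - d) = b * c"
    using assms by Groebner_Basis.algebra
  show thesis
  proof (cases "b = 0 \<and> \<mu> = a")
    case True
    show thesis
    proof (cases "c = 0 \<and> \<mu> = d")
      case True
      then show thesis
        using that[of 1 0] \<open>b = 0 \<and> \<mu> = a\<close> by simp
    next
      case False
      then show thesis
        using that[of "\<mu> - d" c] \<open>b = 0 \<and> \<mu> = a\<close> by (auto simp: algebra_simps)
    qed
  next
    case False
    then show thesis
      using that[of b "\<mu> - a"] det by (auto simp: algebra_simps)
  qed
qed

text \<open>If \<open>f\<close> spans an eigenline of the second matrix with eigenvalue \<open>m\<^sup>-\<^sup>1\<close>, then
  \<open>(f', f)\<close> with \<open>f' = m (A f - m\<^sup>-\<^sup>1 f)\<close> is a basis putting the pair in normal form, unless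
  \<open>f\<close> is an eigenvector of both matrices.\<close>

lemma riley_basis:
  fixes a :: "'a::field"
  assumes A: "a * d - b * c = 1" "a + d = m + mi" and B: "a' * d' - b' * c' = 1" "a' + d' = m + mi"
    and m: "m * mi = 1"
    and f: "u \<noteq> 0 \<or> v \<noteq> 0" "a' * u + b' * v = mi * u" "c' * u + d' * v = mi * v"
    and common: "\<And>\<alpha>. a * u + b * v = \<alpha> * u \<Longrightarrow> c * u + d * v = \<alpha> * v \<Longrightarrow> \<alpha> = mi"
    and ne: "a * u + b * v \<noteq> mi * u \<or> c * u + d * v \<noteq> mi * v"
  obtains P Q q where "P \<in> carrier_mat 2 2" "Q \<in> carrier_mat 2 2" "P * Q = 1\<^sub>m 2" "Q * P = 1\<^sub>m 2"
    "Q * mat2 a b c d * P = mat2 m mi 0 mi" "Q * mat2 a' b' c' d' * P = mat2 m 0 (q * m) mi"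
proof -
  define r s where "r = m * (a * u + b * v - mi * u)" and "s = m * (c * u + d * v - mi * v)"
  define \<delta> where "\<delta> = r * v - u * s"
  have Ae: "a * r + b * s = m * r" "c * r + d * s = m * s"
    unfolding r_def s_def using A m by (Groebner_Basis.algebra, Groebner_Basis.algebra)
  have Af: "a * u + b * v = mi * r + mi * u" "c * u + d * v = mi * s + mi * v"
    unfolding r_def s_def using m by (Groebner_Basis.algebra, Groebner_Basis.algebra)
  have \<delta>: "\<delta> \<noteq> 0"
  proof
    assume "\<delta> = 0"
    then have 0: "(a * u + b * v) * v = u * (c * u + d * v)"
      unfolding \<delta>_def r_def s_def using m by Groebner_Basis.algebra
    \<comment> \<open>If \<open>\<delta>\<close> vanishes, A f is a multiple of f, and the factor is
      read off at a nonzero coordinate.\<close>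
    define \<alpha> where "\<alpha> = (if u \<noteq> 0 then (a * u + b * v) / u else (c * u + d * v) / v)"
    have "a * u + b * v = \<alpha> * u" "c * u + d * v = \<alpha> * v"
      using 0 f(1) by (auto simp: \<alpha>_def field_simps)
    then show False
      using common[of \<alpha>] ne by auto
  qed
  \<comment> \<open>The number \<open>q * m\<close> is the f-coordinate of B f' in the basis (f',
    f), by Cramer's rule; the f'-coordinate is \<open>m\<close> since B has trace
    \<open>m + mi\<close> and B f = \<open>mi\<close> f.\<close>
  define q where "q = mi * (r * (c' * r + d' * s) - s * (a' * r + b' * s)) / \<delta>"
  have q: "q * m * \<delta> = r * (c' * r + d' * s) - s * (a' * r + b' * s)"
  proof -
    have "q * m * \<delta> = (m * mi) * (r * (c' * r + d' * s) - s * (a' * r + b' * s))"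
      using \<delta> by (simp add: q_def)
    then show ?thesis
      unfolding m by simp
  qed
  have Be1: "(a' * r + b' * s) * v - u * (c' * r + d' * s) = m * \<delta>"
    unfolding \<delta>_def using B(2) f(2,3) by Groebner_Basis.algebra
  have "(a' * r + b' * s) * \<delta> = (m * r + q * m * u) * \<delta>" "(c' * r + d' * s) * \<delta> = (m * s + q * m * v) * \<delta>"
    using q Be1 unfolding \<delta>_def by (Groebner_Basis.algebra, Groebner_Basis.algebra)
  then have Be: "a' * r + b' * s = m * r + q * m * u" "c' * r + d' * s = m * s + q * m * v"
    using \<delta> by simp_all
  define i where "i = inverse \<delta>"
  have i: "(r * v - u * s) * i = 1"
    using \<delta> unfolding i_def \<delta>_def by simp
  let ?P = "mat2 r u s v" and ?Q = "mat2 (v * i) (- (u * i)) (- (s * i)) (r * i)"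
  have PQ: "?P * ?Q = 1\<^sub>m 2" and QP: "?Q * ?P = 1\<^sub>m 2"
    using i unfolding mat2_arith mat2_one mat2_eq_iff by (simp_all add: algebra_simps)
  have "mat2 a b c d * ?P = ?P * mat2 m mi 0 mi" "mat2 a' b' c' d' * ?P = ?P * mat2 m 0 (q * m) mi"
    unfolding mat2_arith mat2_eq_iff using Ae Af Be f(2,3) by (simp_all add: ac_simps)
  then have "?Q * mat2 a b c d * ?P = ?Q * ?P * mat2 m mi 0 mi" "?Q * mat2 a' b' c' d' * ?P = ?Q * ?P * mat2 m 0 (q * m) mi"
    by (simp_all only: assoc_mult_mat[OF mat2_carrier mat2_carrier mat2_carrier])
  then have "?Q * mat2 a b c d * ?P = mat2 m mi 0 mi" "?Q * mat2 a' b' c' d' * ?P = mat2 m 0 (q * m) mi"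
    unfolding QP by (simp_all add: left_mult_one_mat[OF mat2_carrier])
  with PQ QP show thesis
    by (intro that[of ?P ?Q q]) simp_all
qed

text \<open>Both matrices have the double eigenvalue m, so their traceless parts are nilpotent with
  a common kernel vector. Such parts are proportional and hence commute.\<close>

lemma mat2_commute_if_common_eigenvector:
  fixes a :: "'a::field"
  assumes "a + d = 2 * m" "a' + d' = 2 * m" "u \<noteq> 0 \<or> v \<noteq> 0"
    and "a * u + b * v = m * u" "c * u + d * v = m * v"
    and "a' * u + b' * v = m * u" "c' * u + d' * v = m * v"
  shows "mat2 a b c d * mat2 a' b' c' d' = mat2 a' b' c' d' * mat2 a b c d"
proof -
  define p p' where "p = a - m" and "p' = a' - m"
  have a: "a = m + p" "d = m - p" "a' = m + p'" "d' = m - p'"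
    using assms(1,2) by (simp_all add: p_def p'_def algebra_simps)
  have e: "b * v = - p * u" "c * u = p * v" "b' * v = - p' * u" "c' * u = p' * v"
    using assms(4-7) unfolding a by (simp_all add: algebra_simps eq_neg_iff_add_eq_0)
  have "b * c' * u\<^sup>2 = b' * c * u\<^sup>2"
    using e by Groebner_Basis.algebra
  moreover have "b * c' * v\<^sup>2 = b' * c * v\<^sup>2"
    using e by Groebner_Basis.algebra
  moreover have "p * b' * u\<^sup>2 = p' * b * u\<^sup>2"
    using e by Groebner_Basis.algebra
  moreover have "p * b' * v\<^sup>2 = p' * b * v\<^sup>2"
    using e by Groebner_Basis.algebra
  moreover have "p * c' * u\<^sup>2 = p' * c * u\<^sup>2"
    using e by Groebner_Basis.algebra
  moreover have "p * c' * v\<^sup>2 = p' * c * v\<^sup>2"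
    using e by Groebner_Basis.algebra
  ultimately have "b * c' = b' * c" "p * b' = p' * b" "p * c' = p' * c"
    using assms(3) by auto
  then show ?thesis
    unfolding mat2_arith mat2_eq_iff a by (simp add: algebra_simps)
qed

text \<open>\<open>riley_basis\<close> is tried on an eigenvector of B for \<open>mi\<close>, then
  with \<open>m\<close> and \<open>mi\<close> exchanged. If both attempts fail, A and B act alike on
  both eigenvectors: they coincide if \<open>m\<close> and \<open>mi\<close> differ, and commute by
  the nilpotent case if not. The hypothesis on common eigenvectors covers reducible nonabelian
  pairs.\<close>

lemma riley_normal_form:
  fixes A B :: "complex mat"
  assumes A: "A \<in> carrier_mat 2 2" "det A = 1" and B: "B \<in> carrier_mat 2 2" "det B = 1"
    and tr: "mat_trace A = mat_trace B" and AB: "A * B \<noteq> B * A"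
    and common: "\<And>u v \<alpha> \<beta>. u \<noteq> 0 \<or> v \<noteq> 0 \<Longrightarrow>
      A * mat2 u 0 v 0 = \<alpha> \<cdot>\<^sub>m mat2 u 0 v 0 \<Longrightarrow> B * mat2 u 0 v 0 = \<beta> \<cdot>\<^sub>m mat2 u 0 v 0 \<Longrightarrow> \<alpha> = \<beta>"
  obtains P Q m mi q where "P \<in> carrier_mat 2 2" "Q \<in> carrier_mat 2 2" "P * Q = 1\<^sub>m 2" "Q * P = 1\<^sub>m 2"
    "m * mi = 1" "Q * A * P = mat2 m mi 0 mi" "Q * B * P = mat2 m 0 (q * m) mi"
proof -
  note result = that
  obtain a b c d where A_eq: "A = mat2 a b c d"
    by (rule mat2_cases[OF A(1)])
  obtain a' b' c' d' where B_eq: "B = mat2 a' b' c' d'"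
    by (rule mat2_cases[OF B(1)])
  have detA: "a * d - b * c = 1" and detB: "a' * d' - b' * c' = 1" and tr': "a + d = a' + d'"
    using A B tr by (simp_all add: A_eq B_eq det_mat2)
  define m where "m = ((a + d) + csqrt ((a + d)\<^sup>2 - 4)) / 2"
  define mi where "mi = (a + d) - m"
  have sum: "a + d = m + mi"
    by (simp add: mi_def)
  have "m * mi = ((a + d)\<^sup>2 - (csqrt ((a + d)\<^sup>2 - 4))\<^sup>2) / 4"
    unfolding mi_def m_def by (simp add: field_simps power2_eq_square)
  then have mmi: "m * mi = 1"
    unfolding power2_csqrt by simp
  have roots: "m\<^sup>2 - (a' + d') * m + 1 = 0" "mi\<^sup>2 - (a' + d') * mi + 1 = 0"
    using mmi unfolding tr'[symmetric] sum by (simp_all add: algebra_simps power2_eq_square)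
  have step: thesis if mmi: "M * M' = 1" "a + d = M + M'"
    and f: "u \<noteq> 0 \<or> v \<noteq> 0" "a' * u + b' * v = M' * u" "c' * u + d' * v = M' * v"
    and ne: "a * u + b * v \<noteq> M' * u \<or> c * u + d * v \<noteq> M' * v" for M M' u v
  proof -
    have tB: "a' + d' = M + M'"
      using tr' mmi(2) by simp
    have c: "\<alpha> = M'" if "a * u + b * v = \<alpha> * u" "c * u + d * v = \<alpha> * v" for \<alpha>
      using common[of u v \<alpha> M'] that f by (simp add: A_eq B_eq mat2_arith)
    show thesis
      by (rule riley_basis[OF detA mmi(2) detB tB mmi(1) f c ne]) (use result mmi(1) in \<open>auto simp: A_eq B_eq\<close>)
  qed
  obtain u v where f: "u \<noteq> 0 \<or> v \<noteq> 0" "a' * u + b' * v = mi * u" "c' * u + d' * v = mi * v"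
    using eigenvector_2[OF detB roots(2)] by blast
  obtain u' v' where f': "u' \<noteq> 0 \<or> v' \<noteq> 0" "a' * u' + b' * v' = m * u'" "c' * u' + d' * v' = m * v'"
    using eigenvector_2[OF detB roots(1)] by blast
  have mmi': "mi * m = 1" "a + d = mi + m"
    using mmi sum by (simp_all add: ac_simps)
  show thesis
  proof (cases "a * u + b * v = mi * u \<and> c * u + d * v = mi * v")
    case False
    then show thesis
      by (intro step[OF mmi sum f]) blast
  next
    case g: True
    show thesis
    proof (cases "a * u' + b * v' = m * u' \<and> c * u' + d * v' = m * v'")
      case False
      then show thesis
        by (intro step[OF mmi' f']) blast
    next
      case g': True
      have "A * B = B * A"
      proof (cases "m = mi")
        case True
        then show ?thesis
          unfolding A_eq B_eq using f g sum tr'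
          by (intro mat2_commute_if_common_eigenvector[of a d m a' d' u v]) auto
      next
        case False
        have "u * v' - u' * v \<noteq> 0"
        proof
          assume "u * v' - u' * v = 0"
          then have "(m - mi) * (u * u') = 0" "(m - mi) * (u * v') = 0" "(m - mi) * (v * u') = 0" "(m - mi) * (v * v') = 0"
            using f(2,3) f'(2,3) by (Groebner_Basis.algebra, Groebner_Basis.algebra, Groebner_Basis.algebra, Groebner_Basis.algebra)
          then show False
            using False f(1) f'(1) by auto
        qed
        moreover have "(a - a') * (u * v' - u' * v) = 0" "(b - b') * (u * v' - u' * v) = 0"
          "(c - c') * (u * v' - u' * v) = 0" "(d - d') * (u * v' - u' * v) = 0"
          using f(2,3) f'(2,3) g g' by (Groebner_Basis.algebra, Groebner_Basis.algebra, Groebner_Basis.algebra, Groebner_Basis.algebra)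
        ultimately have "a = a'" "b = b'" "c = c'" "d = d'"
          by simp_all
        then show ?thesis
          by (simp add: A_eq B_eq)
      qed
      with AB show thesis ..
    qed
  qed
qed

section \<open>The adjoint representation\<close>

definition sl2_vec :: "complex mat \<Rightarrow> complex vec" where
  "sl2_vec X = vec 3 (\<lambda>i. if i = 0 then X $$ (0, 0) else if i = 1 then X $$ (0, Suc 0) else X $$ (Suc 0, 0))"

lemma sl2_vec_carrier [simp]: "sl2_vec X \<in> carrier_vec 3"
  by (simp add: sl2_vec_def)

lemma sl2_vec_dim [simp]: "dim_vec (sl2_vec X) = 3"
  by (simp add: sl2_vec_def)

lemma sl2_vec_index [simp]:
  "sl2_vec X $ 0 = X $$ (0, 0)" "sl2_vec X $ Suc 0 = X $$ (0, Suc 0)" "sl2_vec X $ 2 = X $$ (Suc 0, 0)"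
  by (simp_all add: sl2_vec_def)

lemma vec3_eqI:
  assumes "v \<in> carrier_vec 3" "w \<in> carrier_vec 3" "v $ 0 = w $ 0" "v $ Suc 0 = w $ Suc 0" "v $ 2 = w $ 2"
  shows "v = w"
proof (rule eq_vecI)
  have "\<forall>i<3. v $ i = w $ i"
    using assms(3-5) by (simp add: all_less_3)
  then show "\<And>i. i < dim_vec w \<Longrightarrow> v $ i = w $ i"
    using assms(2) by auto
qed (use assms in auto)

lemma sl2_mat2: "X \<in> sl2 \<longleftrightarrow> (\<exists>a b c. X = mat2 a b c (- a))"
proof
  assume "X \<in> sl2"
  then have X': "X \<in> carrier_mat 2 2" and tr: "mat_trace X = 0"
    by (simp_all add: sl2_def)
  obtain a b c d where X: "X = mat2 a b c d"
    by (rule mat2_cases[OF X'])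
  with tr have "d = - a"
    by (simp add: eq_neg_iff_add_eq_0 add.commute)
  with X show "\<exists>a b c. X = mat2 a b c (- a)"
    by blast
qed (auto simp: sl2_def)

lemma inv_SL2_mat2:
  assumes "a * d - b * c = 1"
  shows "inv\<^bsub>SL 2\<^esub> (mat2 a b c d) = mat2 d (- b) (- c) a"
  by (rule group.inv_equality[OF group_SL])
    (use assms in \<open>auto simp: SL_def det_mat2 mat2_arith mat2_one algebra_simps\<close>)

lemma Ad_mat2:
  assumes "A \<in> carrier (SL 2)" "X \<in> sl2"
  shows "Ad A X \<in> sl2" "sl2_vec (Ad A X) = adm A *\<^sub>v sl2_vec X"
proof -
  have A': "A \<in> carrier_mat 2 2" "det A = 1"
    using assms(1) by (simp_all add: SL_def)
  obtain a b c d where A: "A = mat2 a b c d"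
    by (rule mat2_cases[OF A'(1)])
  then have det: "a * d - b * c = 1"
    using A'(2) by (simp add: det_mat2)
  obtain p q r where X: "X = mat2 p q r (- p)"
    using assms(2) by (auto simp: sl2_mat2)
  show "Ad A X \<in> sl2"
    unfolding Ad_def A X inv_SL2_mat2[OF det] mat2_arith
    by (simp add: sl2_def algebra_simps)
  show "sl2_vec (Ad A X) = adm A *\<^sub>v sl2_vec X"
    unfolding Ad_def A X inv_SL2_mat2[OF det] mat2_arith
    by (rule vec3_eqI)
      (simp_all add: ad3_def scalar_prod_def sum_upto_2_3 algebra_simps mult_mat_vec_carrier[OF mat3_carrier])
qed

text \<open>Change of basis: the columns of C are the given basis in standard coordinates, and those
  of D are the standard basis in the given coordinates.\<close>

lemma Ad_mat_conjugate:
  assumes "sl2_basis B"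
  obtains C D where "C \<in> carrier_mat 3 3" "D \<in> carrier_mat 3 3" "C * D = 1\<^sub>m 3"
    "\<And>A. A \<in> carrier (SL 2) \<Longrightarrow> Ad_mat B A = D * adm A * C"
proof -
  have B: "B i \<in> sl2" if "i < 3" for i
    using assms that by (simp add: sl2_basis_def)
  have bij: "bij_betw (lin_comb3 B) (carrier_vec 3) sl2"
    using assms by (simp add: sl2_basis_def)
  have dim: "dim_row (B i) = 2" "dim_col (B i) = 2" if "i < 3" for i
    using B[OF that] by (auto simp: sl2_def)
  define C where "C = mat_of_cols 3 (map (\<lambda>j. sl2_vec (B j)) [0..<3])"
  have C [simp]: "C \<in> carrier_mat 3 3"
    by (simp add: C_def mat_of_cols_def)
  have col_C: "col C j = sl2_vec (B j)" if "j < 3" for j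
    using that unfolding C_def by (subst col_mat_of_cols) simp_all
  have lin_comb: "sl2_vec (lin_comb3 B v) = C *\<^sub>v v" if "v \<in> carrier_vec 3" for v
  proof -
    have C_index: "C $$ (i, k) = sl2_vec (B k) $ i" if "i < 3" "k < 3" for i k
      using that unfolding C_def by (simp add: mat_of_cols_index)
    have "lin_comb3 B v $$ (i, k) = v $ 0 * B 0 $$ (i, k) + v $ 1 * B 1 $$ (i, k) + v $ 2 * B 2 $$ (i, k)"
      if "i < 2" "k < 2" for i k
      using that by (simp add: lin_comb3_def dim)
    with that show ?thesis
      by (intro vec3_eqI)
        (simp_all add: carrier_matD[OF C] mult_mat_vec_carrier[OF C] scalar_prod_def sum_upto_2_3 C_index carrier_vecD[OF that] mult.commute)
  qed
  have coords: "coords B X \<in> carrier_vec 3" "C *\<^sub>v coords B X = sl2_vec X" if "X \<in> sl2" for X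
  proof -
    show "coords B X \<in> carrier_vec 3"
      using bij that unfolding coords_def by (metis bij_betw_def inv_into_into)
    have "lin_comb3 B (coords B X) = X"
      using bij that unfolding coords_def by (metis bij_betw_inv_into_right)
    then show "C *\<^sub>v coords B X = sl2_vec X"
      using lin_comb[OF \<open>coords B X \<in> carrier_vec 3\<close>] by simp
  qed
  define E where "E = (\<lambda>j::nat. if j = 0 then mat2 1 0 0 (- 1) else if j = 1 then mat2 0 1 0 0 else mat2 0 0 1 (0::complex))"
  have E: "E j \<in> sl2" for j
    unfolding E_def sl2_mat2 by (auto intro: exI[of _ 0])
  define D where "D = mat_of_cols 3 (map (\<lambda>j. coords B (E j)) [0..<3])"
  have D [simp]: "D \<in> carrier_mat 3 3"
    by (simp add: D_def mat_of_cols_def)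
  have col_D: "col D j = coords B (E j)" if "j < 3" for j
    using that coords(1)[OF E] unfolding D_def by (subst col_mat_of_cols) simp_all
  have CD: "C * D = 1\<^sub>m 3"
  proof (rule mat_col_eqI)
    fix j assume "j < dim_col (1\<^sub>m 3 :: complex mat)"
    then have j: "j < 3"
      by simp
    have "\<forall>j<3. sl2_vec (E j) = unit_vec 3 j"
      unfolding all_less_3 by (auto intro!: vec3_eqI simp: E_def)
    then show "col (C * D) j = col (1\<^sub>m 3) j"
      using j by (simp add: col_mult2[OF C D] col_D coords(2)[OF E])
  qed (simp_all add: carrier_matD[OF C] carrier_matD[OF D])
  then have DC: "D * C = 1\<^sub>m 3"
    by (rule mat_mult_left_right_inverse[OF C D])
  have coords_eq: "coords B X = D *\<^sub>v sl2_vec X" if "X \<in> sl2" for X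
  proof -
    have "D *\<^sub>v sl2_vec X = D *\<^sub>v (C *\<^sub>v coords B X)"
      using coords[OF that] by simp
    also have "\<dots> = D * C *\<^sub>v coords B X"
      using coords(1)[OF that] by (simp add: assoc_mult_mat_vec[OF D C])
    finally show ?thesis
      using coords(1)[OF that] by (simp add: DC)
  qed
  show thesis
  proof (rule that[OF C D])
    show "C * D = 1\<^sub>m 3"
      by (rule CD)
    fix A assume A: "A \<in> carrier (SL 2)"
    show "Ad_mat B A = D * adm A * C"
    proof (rule mat_col_eqI)
      fix j assume "j < dim_col (D * adm A * C)"
      then have j: "j < 3"
        using C by auto
      have "col (Ad_mat B A) j = coords B (Ad A (B j))"
        using j coords(1)[OF Ad_mat2(1)[OF A B[OF j]]] unfolding Ad_mat_def by (subst col_mat_of_cols) simp_all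
      also have "\<dots> = D *\<^sub>v (adm A *\<^sub>v col C j)"
        by (simp add: coords_eq Ad_mat2[OF A B[OF j]] col_C[OF j])
      also have "\<dots> = col (D * adm A * C) j"
        using j by (simp add: col_mult2[of _ 3 3 _ 3] assoc_mult_mat_vec[of _ 3 3 _ 3] mult_carrier_mat[of _ 3 3])
      finally show "col (Ad_mat B A) j = col (D * adm A * C) j" .
    qed (simp_all add: carrier_matD[OF C] carrier_matD[OF D] Ad_mat_def)
  qed
qed

lemma Phi_conjugate:
  assumes U: "U \<in> carrier_mat N N" and V: "V \<in> carrier_mat N N"
    and \<tau>: "\<And>g. g \<in> carrier (free_grp l) \<Longrightarrow> \<tau> (pres_class l rs g) \<in> carrier_mat N N"
    and \<sigma>: "\<And>g. g \<in> carrier (free_grp l) \<Longrightarrow> \<sigma> (pres_class l rs g) = U * \<tau> (pres_class l rs g) * V"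
    and z: "Poly_Mapping.keys z \<subseteq> carrier (free_grp l)"
  shows "Phi l rs N f \<sigma> z = map_mat cst U * Phi l rs N f \<tau> z * map_mat cst V"
  using z
proof (induction rule: frag_induction)
  case zero
  have "map_mat cst U * 0\<^sub>m N N * map_mat cst V = 0\<^sub>m N N"
    using U V by simp
  then show ?case
    by (simp add: Phi_zero)
next
  case (one g)
  have c: "\<tau> (pres_class l rs g) \<in> carrier_mat N N" "\<sigma> (pres_class l rs g) \<in> carrier_mat N N"
    using \<tau>[OF one] \<sigma>[OF one] U V by (simp_all add: mult_carrier_mat[of _ N N])
  have "map_mat cst (\<sigma> (pres_class l rs g)) = map_mat cst U * map_mat cst (\<tau> (pres_class l rs g)) * map_mat cst V"
    using U V c by (simp add: \<sigma>[OF one] map_mat_cst_mult[of _ N N _ N] mult_carrier_mat[of _ N N])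
  then show ?case
    using U V c by (simp add: Phi_elt mult_smult_distrib[of _ N N] mult_smult_assoc_mat[of _ N N] mult_carrier_mat[of _ N N])
next
  case (diff a b)
  then show ?case
    using U V by (simp add: Phi_diff mult_minus_distrib_mat[of _ N N _ N] minus_mult_distrib_mat[of _ N N _ _ N] mult_carrier_mat[of _ N N])
qed

lemma mat_trace_mult_commute:
  fixes A :: "'a::comm_ring_1 mat"
  assumes "A \<in> carrier_mat 2 2" "B \<in> carrier_mat 2 2"
  shows "mat_trace (A * B) = mat_trace (B * A)"
proof -
  obtain a b c d where A: "A = mat2 a b c d"
    by (rule mat2_cases[OF assms(1)])
  obtain a' b' c' d' where B: "B = mat2 a' b' c' d'"
    by (rule mat2_cases[OF assms(2)])
  show ?thesis
    unfolding A B by (simp add: mat2_arith algebra_simps)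
qed

lemma twist_alexander_eq:
  "twist_alexander n 3 f \<sigma> 0 = det (Phi 2 [twist_relator n] 3 f \<sigma> (fox 1 (twist_relator n)))
    / det (Phi 2 [twist_relator n] 3 f \<sigma> (1 - elt (gen 0)))"
  "twist_alexander n 3 f \<sigma> 1 = det (Phi 2 [twist_relator n] 3 f \<sigma> (fox 0 (twist_relator n)))
    / det (Phi 2 [twist_relator n] 3 f \<sigma> (1 - elt (gen 1)))"
proof -
  have "fox_matrix_delete 2 [twist_relator n] 3 f \<sigma> j = Phi 2 [twist_relator n] 3 f \<sigma> (fox (1 - j) (twist_relator n))"
    if "j < 2" for j
    by (rule eq_matI)
      (use that in \<open>auto simp: fox_matrix_delete_def fox_matrix_def insert_index_def less_2_cases_iff\<close>)
  from this[of 0] this[of 1] show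
    "twist_alexander n 3 f \<sigma> 0 = det (Phi 2 [twist_relator n] 3 f \<sigma> (fox 1 (twist_relator n)))
    / det (Phi 2 [twist_relator n] 3 f \<sigma> (1 - elt (gen 0)))"
    "twist_alexander n 3 f \<sigma> 1 = det (Phi 2 [twist_relator n] 3 f \<sigma> (fox 0 (twist_relator n)))
    / det (Phi 2 [twist_relator n] 3 f \<sigma> (1 - elt (gen 1)))"
    by (simp_all add: twist_alexander_def twisted_alexander_def)
qed

lemma eigen_smult_cancel:
  fixes \<alpha> :: "'a::field"
  assumes "u \<noteq> 0 \<or> v \<noteq> 0" "\<alpha> \<cdot>\<^sub>m mat2 u 0 v 0 = \<beta> \<cdot>\<^sub>m mat2 u 0 v 0"
  shows "\<alpha> = \<beta>"
  using assms by (auto simp: mat2_arith)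

section \<open>Commutation and common eigenvectors, from the generators to all words\<close>

context fox_rep
begin

lemma \<rho>_inverse:
  assumes "g \<in> carrier (free_grp 2)"
  shows "\<rho> (pres_class 2 rs (- g)) * \<rho> (pres_class 2 rs g) = 1\<^sub>m 2"
    and "\<rho> (pres_class 2 rs g) * \<rho> (pres_class 2 rs (- g)) = 1\<^sub>m 2"
  using \<rho>_mult[of "- g" g] \<rho>_mult[of g "- g"] assms by (simp_all add: \<rho>_zero)

lemma commute_if_commute_gen:
  assumes X: "X \<in> carrier_mat 2 2" and "X * \<rho> (pres_class 2 rs (gen 0)) = \<rho> (pres_class 2 rs (gen 0)) * X"
    and "X * \<rho> (pres_class 2 rs (gen 1)) = \<rho> (pres_class 2 rs (gen 1)) * X"
    and "g \<in> carrier (free_grp 2)"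
  shows "X * \<rho> (pres_class 2 rs g) = \<rho> (pres_class 2 rs g) * X"
  using assms(4)
proof (induction rule: free_grp_induct)
  case zero
  show ?case
    using X by (simp add: \<rho>_zero)
next
  case (gen i)
  then show ?case
    using assms(2,3) by (auto simp: less_2_cases_iff)
next
  case (uminus g)
  let ?Y = "\<rho> (pres_class 2 rs g)" and ?Z = "\<rho> (pres_class 2 rs (- g))"
  have c: "?Y \<in> carrier_mat 2 2" "?Z \<in> carrier_mat 2 2"
    using uminus(1) by (simp_all add: \<rho>_carrier)
  note a = assoc_mult_mat[of _ 2 2 _ 2 _ 2] mult_carrier_mat[of _ 2 2]
  have "?Z * X = ?Z * (X * ?Y) * ?Z"
    using \<rho>_inverse[OF uminus(1)] c X by (simp add: a)
  also have "\<dots> = (?Z * ?Y) * X * ?Z"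
    unfolding uminus(2) using c X by (simp add: a)
  finally show ?case
    using \<rho>_inverse[OF uminus(1)] c X by (simp add: a)
next
  case (plus g h)
  let ?Y = "\<rho> (pres_class 2 rs g)" and ?Z = "\<rho> (pres_class 2 rs h)"
  have c: "?Y \<in> carrier_mat 2 2" "?Z \<in> carrier_mat 2 2"
    using plus by (simp_all add: \<rho>_carrier)
  note a = assoc_mult_mat[of _ 2 2 _ 2 _ 2] mult_carrier_mat[of _ 2 2]
  have "X * (?Y * ?Z) = X * ?Y * ?Z"
    using c X by (simp add: a)
  also have "\<dots> = ?Y * (X * ?Z)"
    unfolding plus(3) using c X by (simp add: a)
  also have "\<dots> = ?Y * ?Z * X"
    unfolding plus(4) using c X by (simp add: a)
  finally show ?case
    using plus by (simp add: \<rho>_mult)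
qed

text \<open>Needed for w^n: a nonzero eigenvalue there lets the relation compare the eigenvalues of
  the two meridians. A vector is stored as the first column of a matrix with zero second column, so
  that matrix algebra suffices.\<close>

lemma common_eigenvector:
  assumes uv: "u \<noteq> 0 \<or> v \<noteq> 0"
    and "\<rho> (pres_class 2 rs (gen 0)) * mat2 u 0 v 0 = \<alpha> \<cdot>\<^sub>m mat2 u 0 v 0"
    and "\<rho> (pres_class 2 rs (gen 1)) * mat2 u 0 v 0 = \<beta> \<cdot>\<^sub>m mat2 u 0 v 0"
    and "g \<in> carrier (free_grp 2)"
  shows "\<exists>\<chi>. \<rho> (pres_class 2 rs g) * mat2 u 0 v 0 = \<chi> \<cdot>\<^sub>m mat2 u 0 v 0 \<and> \<chi> \<noteq> 0"
proof -
  let ?E = "mat2 u 0 v 0"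
  note a = assoc_mult_mat[of _ 2 2 _ 2 _ 2] mult_carrier_mat[of _ 2 2] mult_smult_distrib[of _ 2 2 _ 2]
    smult_smult_assoc
  have inv: "?E = \<chi> \<cdot>\<^sub>m (\<rho> (pres_class 2 rs (- g)) * ?E)"
    if "g \<in> carrier (free_grp 2)" "\<rho> (pres_class 2 rs g) * ?E = \<chi> \<cdot>\<^sub>m ?E" for g \<chi>
  proof -
    have c: "\<rho> (pres_class 2 rs g) \<in> carrier_mat 2 2" "\<rho> (pres_class 2 rs (- g)) \<in> carrier_mat 2 2"
      using that(1) by (simp_all add: \<rho>_carrier)
    have "?E = \<rho> (pres_class 2 rs (- g)) * \<rho> (pres_class 2 rs g) * ?E"
      by (simp add: \<rho>_inverse[OF that(1)] left_mult_one_mat[OF mat2_carrier])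
    also have "\<dots> = \<rho> (pres_class 2 rs (- g)) * (\<chi> \<cdot>\<^sub>m ?E)"
      using c by (simp add: a that(2))
    finally show ?thesis
      using c by (simp add: a)
  qed
  have nz: "\<chi> \<noteq> 0"
    if "g \<in> carrier (free_grp 2)" "\<rho> (pres_class 2 rs g) * ?E = \<chi> \<cdot>\<^sub>m ?E" for g \<chi>
  proof
    assume "\<chi> = 0"
    moreover have "\<rho> (pres_class 2 rs (- g)) * ?E \<in> carrier_mat 2 2"
      using that(1) by (intro mult_carrier_mat[of _ 2 2] \<rho>_carrier) simp_all
    ultimately have "?E = mat2 0 0 0 0"
      using inv[OF that] by (metis mat2_cases mat2_arith(3) mult_zero_left)
    with uv show False
      by simp
  qed
  show ?thesis
    using assms(4)
  proof (induction rule: free_grp_induct)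
    case zero
    show ?case
      by (intro exI[of _ 1]) (simp add: \<rho>_zero left_mult_one_mat[OF mat2_carrier])
  next
    case (gen i)
    then have "\<exists>\<chi>. \<rho> (pres_class 2 rs (gen i)) * ?E = \<chi> \<cdot>\<^sub>m ?E"
      using assms(2,3) by (auto simp: less_2_cases_iff)
    then show ?case
      using nz gen by (metis gen_in_free_grp)
  next
    case (uminus g)
    then obtain \<chi> where \<chi>: "\<rho> (pres_class 2 rs g) * ?E = \<chi> \<cdot>\<^sub>m ?E" "\<chi> \<noteq> 0"
      by blast
    obtain a b c d where X: "\<rho> (pres_class 2 rs (- g)) * ?E = mat2 a b c d"
      using mat2_cases[of "\<rho> (pres_class 2 rs (- g)) * ?E"] uminus(1)
      by (metis \<rho>_carrier mat2_carrier mult_carrier_mat uminus_in_free_grp)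
    have "mat2 a b c d = inverse \<chi> \<cdot>\<^sub>m ?E"
      using inv[OF uminus(1) \<chi>(1)] \<chi>(2) unfolding X by (auto simp: mat2_arith)
    then show ?case
      using X \<chi>(2) by (intro exI[of _ "inverse \<chi>"]) simp
  next
    case (plus g h)
    then obtain \<chi> \<chi>' where \<chi>: "\<rho> (pres_class 2 rs g) * ?E = \<chi> \<cdot>\<^sub>m ?E" "\<chi> \<noteq> 0"
      "\<rho> (pres_class 2 rs h) * ?E = \<chi>' \<cdot>\<^sub>m ?E" "\<chi>' \<noteq> 0"
      by blast
    have c: "\<rho> (pres_class 2 rs g) \<in> carrier_mat 2 2" "\<rho> (pres_class 2 rs h) \<in> carrier_mat 2 2"
      using plus(1,2) by (simp_all add: \<rho>_carrier)
    have "\<rho> (pres_class 2 rs (g + h)) * ?E = \<rho> (pres_class 2 rs g) * (\<chi>' \<cdot>\<^sub>m ?E)"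
      using plus(1,2) c by (simp add: \<rho>_mult a \<chi>(3))
    also have "\<dots> = (\<chi>' * \<chi>) \<cdot>\<^sub>m ?E"
      using c by (simp add: a \<chi>(1)) (simp add: mat2_arith)
    finally show ?case
      using \<chi> by (intro exI[of _ "\<chi>' * \<chi>"]) simp
  qed
qed

end

section \<open>Reduction of the theorem to the normal form\<close>

theorem theorem2p5:
  fixes n :: int
    and \<rho> :: "nat free_group set \<Rightarrow> complex mat"
    and f :: "nat free_group set \<Rightarrow> int"
    and B :: "nat \<Rightarrow> complex mat"
    and x y :: complex
    and R :: ratfun
  assumes "n \<noteq> 0"
    and "is_abelianization (twist_group n) f" and "f (mer_a n) = 1"
    and "\<rho> \<in> hom (twist_group n) (SL 2)"
    and "\<exists>g\<in>carrier (twist_group n). \<exists>h\<in>carrier (twist_group n). \<rho> g * \<rho> h \<noteq> \<rho> h * \<rho> g"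
    and "sl2_basis B"
    and "x = mat_trace (\<rho> (mer_a n))"
    and "y = mat_trace (\<rho> (mer_a n \<otimes>\<^bsub>twist_group n\<^esub> inv\<^bsub>twist_group n\<^esub> mer_b n))"
    and "y^2 - y * x^2 + 2 * x^2 \<noteq> 0"
    and "R = (tvar - 1) / cst ((y + 2 - x^2) * (y^2 - y * x^2 + x^2))
      * (of_int n * tvar^2
         + cst (((2 * of_int n - 1) * y^2 + y * x^2 - 2 * of_int n * x^2 * (x^2 - 2))
                / (y^2 - y * x^2 + 2 * x^2)) * tvar
         + of_int n)"
  shows "mat_trace (\<rho> (mer_b n)) = x
    \<and> (y + 2 - x^2) * (y^2 - y * x^2 + x^2) \<noteq> 0
    \<and> eq_upto_unit 3 (twist_alexander n 3 f (Ad_mat B \<circ> \<rho>) 0) R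
    \<and> eq_upto_unit 3 (twist_alexander n 3 f (Ad_mat B \<circ> \<rho>) 1) (- R)"
proof -
  define rs where "rs = [twist_relator n]"
  let ?G = "free_grp 2" and ?K = "presented_group 2 rs" and ?\<pi> = "pres_class 2 rs"
  let ?r = "twist_relator n" and ?w = "twist_w_pow n"
  have K: "twist_group n = ?K" and mer: "mer_a n = ?\<pi> (gen 0)" "mer_b n = ?\<pi> (gen 1)"
    by (simp_all add: twist_group_def mer_a_def mer_b_def rs_def)
  have rs: "set rs \<subseteq> carrier ?G"
    by (simp add: rs_def)
  note group_K = group_presented_group[OF rs]
  interpret \<pi>: group_hom ?G ?K ?\<pi>
    by (intro group_hom.intro group_hom_axioms.intro group_free_grp group_K pres_class_hom rs)
  interpret \<rho>: group_hom ?K "SL 2" \<rho>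
    using assms(4) unfolding K by (intro group_hom.intro group_hom_axioms.intro group_SL group_K)
  interpret f: group_hom ?K integer_group f
    using assms(2) unfolding K is_abelianization_def
    by (intro group_hom.intro group_hom_axioms.intro group_integer_group group_K) simp
  have SL: "\<rho> (?\<pi> g) \<in> carrier_mat 2 2" "det (\<rho> (?\<pi> g)) = 1" if "g \<in> carrier ?G" for g
    using \<rho>.hom_closed[OF \<pi>.hom_closed[OF that]] by (simp_all add: SL_def)
  have f_add: "f (?\<pi> (g + h)) = f (?\<pi> g) + f (?\<pi> h)" if "g \<in> carrier ?G" "h \<in> carrier ?G" for g h
    using that \<pi>.hom_mult[OF that] f.hom_mult[of "?\<pi> g" "?\<pi> h"] by simp
  have \<rho>_mult: "\<rho> (?\<pi> (g + h)) = \<rho> (?\<pi> g) * \<rho> (?\<pi> h)" if "g \<in> carrier ?G" "h \<in> carrier ?G" for g h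
    using that \<pi>.hom_mult[OF that] \<rho>.hom_mult[of "?\<pi> g" "?\<pi> h"] by (simp add: SL_def)
  have \<rho>_zero: "\<rho> (?\<pi> 0) = 1\<^sub>m 2"
    using \<pi>.hom_one \<rho>.hom_one by (simp add: SL_def)
  interpret fox_rep rs f \<rho>
    by unfold_locales (fact f_add \<rho>_mult SL(1) \<rho>_zero)+
  have rel: "?\<pi> ?r = \<one>\<^bsub>?K\<^esub>"
    by (rule pres_class_relator[OF rs]) (simp add: rs_def)
  have f_rel: "f (?\<pi> ?r) = 0" and \<rho>_rel: "\<rho> (?\<pi> ?r) = 1\<^sub>m 2"
    using f.hom_one \<rho>.hom_one by (simp_all add: rel SL_def)
  have swap: "?w + gen 0 = ?r + (gen 1 + ?w)"
    unfolding twist_relator_eq by (simp only: add.assoc left_minus add_0_right)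
  have f_a: "f (?\<pi> (gen 0)) = 1"
    using assms(3) by (simp add: mer)
  \<comment> \<open>The relation conjugates one meridian into the other, so f takes the same value
    on both.\<close>
  have f_b: "f (?\<pi> (gen 1)) = 1"
    using arg_cong[OF swap, of "\<lambda>g. f (?\<pi> g)"] f_a f_rel by (simp add: f_add)
  define A where "A = \<rho> (?\<pi> (gen 0))"
  define B' where "B' = \<rho> (?\<pi> (gen 1))"
  define W where "W = \<rho> (?\<pi> ?w)"
  define W' where "W' = \<rho> (?\<pi> (- ?w))"
  have c: "A \<in> carrier_mat 2 2" "B' \<in> carrier_mat 2 2" "W \<in> carrier_mat 2 2" "W' \<in> carrier_mat 2 2"
    unfolding A_def B'_def W_def W'_def by (intro SL; simp)+
  have WA: "W * A = B' * W"
    using arg_cong[OF swap, of "\<lambda>g. \<rho> (?\<pi> g)"] c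
    unfolding A_def B'_def W_def by (simp add: \<rho>_mult \<rho>_rel left_mult_one_mat[OF mult_carrier_mat[of _ 2 2]])
  have W'W: "W' * W = 1\<^sub>m 2" and WW': "W * W' = 1\<^sub>m 2"
    unfolding W_def W'_def using \<rho>_mult[of "- ?w" ?w] \<rho>_mult[of ?w "- ?w"] by (simp_all add: \<rho>_zero)
  note a = assoc_mult_mat[of _ 2 2 _ 2 _ 2] mult_carrier_mat[of _ 2 2]
  have tr: "mat_trace A = mat_trace B'"
  proof -
    have "A = W' * W * A"
      using c by (simp add: W'W)
    also have "\<dots> = W' * (B' * W)"
      using c WA by (simp add: a)
    finally have "mat_trace A = mat_trace (B' * W * W')"
      using mat_trace_mult_commute[of W' "B' * W"] c by (simp add: a)
    then show ?thesis
      using c WW' by (simp add: a)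
  qed
  have AB: "A * B' \<noteq> B' * A"
  proof
    assume AB: "A * B' = B' * A"
    have comm: "A * \<rho> (?\<pi> g) = \<rho> (?\<pi> g) * A" if "g \<in> carrier ?G" for g
      by (rule commute_if_commute_gen[OF c(1) _ _ that]) (simp_all only: A_def[symmetric] B'_def[symmetric] AB)
    have comm': "B' * \<rho> (?\<pi> g) = \<rho> (?\<pi> g) * B'" if "g \<in> carrier ?G" for g
      by (rule commute_if_commute_gen[OF c(2) _ _ that]) (simp_all only: A_def[symmetric] B'_def[symmetric] AB)
    have "\<rho> (?\<pi> g) * \<rho> (?\<pi> h) = \<rho> (?\<pi> h) * \<rho> (?\<pi> g)" if "g \<in> carrier ?G" "h \<in> carrier ?G" for g h
      by (rule commute_if_commute_gen[OF SL(1)[OF that(1)] _ _ that(2)])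
        (simp_all only: A_def[symmetric] B'_def[symmetric] comm[OF that(1)] comm'[OF that(1)])
    then show False
      using assms(5) unfolding K pres_class_surj[OF rs] by blast
  qed
  \<comment> \<open>Applying W A = B' W to a common eigenvector gives \<alpha> \<chi> = \<beta>
    \<chi> with \<chi> nonzero.\<close>
  have common: "\<alpha> = \<beta>" if uv: "u \<noteq> 0 \<or> v \<noteq> 0"
      and A: "A * mat2 u 0 v 0 = \<alpha> \<cdot>\<^sub>m mat2 u 0 v 0" and B: "B' * mat2 u 0 v 0 = \<beta> \<cdot>\<^sub>m mat2 u 0 v 0" for u v \<alpha> \<beta>
  proof -
    let ?E = "mat2 u 0 v 0"
    obtain \<chi> where \<chi>: "W * ?E = \<chi> \<cdot>\<^sub>m ?E" "\<chi> \<noteq> 0"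
      using common_eigenvector[OF uv A[unfolded A_def] B[unfolded B'_def] twist_w_pow_in[of n]]
      unfolding W_def by blast
    have "(\<alpha> * \<chi>) \<cdot>\<^sub>m ?E = W * (A * ?E)"
      using c by (simp add: A \<chi>(1) mult_smult_distrib[of _ 2 2 _ 2]) (simp add: mat2_arith)
    also have "\<dots> = W * A * ?E"
      using c by (simp add: a)
    also have "\<dots> = B' * (W * ?E)"
      unfolding WA using c by (simp add: a)
    also have "\<dots> = (\<beta> * \<chi>) \<cdot>\<^sub>m ?E"
      using c by (simp add: B \<chi>(1) mult_smult_distrib[of _ 2 2 _ 2]) (simp add: mat2_arith)
    finally show ?thesis
      using eigen_smult_cancel[OF uv] \<chi>(2) by fastforce
  qed
  have det: "det A = 1" "det B' = 1"
    unfolding A_def B'_def by (intro SL; simp)+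
  obtain P Q m mi q where PQ: "P \<in> carrier_mat 2 2" "Q \<in> carrier_mat 2 2" "P * Q = 1\<^sub>m 2" "Q * P = 1\<^sub>m 2"
    and m: "m * mi = 1" and nf: "Q * A * P = mat2 m mi 0 mi" "Q * B' * P = mat2 m 0 (q * m) mi"
  proof (rule riley_normal_form[OF c(1) det(1) c(2) det(2) tr AB])
    show "\<alpha> = \<beta>" if "u \<noteq> 0 \<or> v \<noteq> 0" "A * mat2 u 0 v 0 = \<alpha> \<cdot>\<^sub>m mat2 u 0 v 0"
      "B' * mat2 u 0 v 0 = \<beta> \<cdot>\<^sub>m mat2 u 0 v 0" for u v \<alpha> \<beta>
      by (rule common[OF that])
  qed (rule that)
  define \<rho>' where "\<rho>' X = Q * \<rho> X * P" for X
  have \<rho>'_mult: "\<rho>' (?\<pi> (g + h)) = \<rho>' (?\<pi> g) * \<rho>' (?\<pi> h)" if "g \<in> carrier ?G" "h \<in> carrier ?G" for g h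
  proof -
    let ?X = "\<rho> (?\<pi> g)" and ?Y = "\<rho> (?\<pi> h)"
    have "\<rho>' (?\<pi> g) * \<rho>' (?\<pi> h) = Q * ?X * (P * Q) * ?Y * P"
      using SL(1)[OF that(1)] SL(1)[OF that(2)] PQ(1,2) unfolding \<rho>'_def by (simp add: a)
    then show ?thesis
      using SL(1)[OF that(1)] SL(1)[OF that(2)] PQ(1,2) that unfolding PQ(3) \<rho>'_def by (simp add: a \<rho>_mult)
  qed
  have \<rho>'_carrier: "\<rho>' (?\<pi> g) \<in> carrier_mat 2 2" if "g \<in> carrier ?G" for g
    using SL(1)[OF that] PQ by (simp add: \<rho>'_def mult_carrier_mat[of _ 2 2])
  have trace: "mat_trace (\<rho>' (?\<pi> g)) = mat_trace (\<rho> (?\<pi> g))" if "g \<in> carrier ?G" for g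
  proof -
    have "mat_trace (\<rho>' (?\<pi> g)) = mat_trace (P * (Q * \<rho> (?\<pi> g)))"
      unfolding \<rho>'_def by (rule mat_trace_mult_commute) (use SL(1)[OF that] PQ(1,2) in \<open>simp_all add: a\<close>)
    also have "P * (Q * \<rho> (?\<pi> g)) = P * Q * \<rho> (?\<pi> g)"
      using SL(1)[OF that] PQ(1,2) by (simp add: a)
    finally show ?thesis
      using SL(1)[OF that] by (simp add: PQ(3))
  qed
  interpret \<rho>': fox_rep rs f \<rho>'
    using f_add \<rho>'_mult \<rho>'_carrier PQ by unfold_locales (simp_all add: \<rho>'_def \<rho>_zero)
  have x: "x = m + mi"
    using trace[of "gen 0"] nf(1) assms(7) by (simp add: mer \<rho>'_def A_def)
  have y: "y = 2 - q"
  proof -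
    have "mer_a n \<otimes>\<^bsub>twist_group n\<^esub> inv\<^bsub>twist_group n\<^esub> mer_b n = ?\<pi> (gen 0 + - gen 1)"
      using \<pi>.hom_mult[of "gen 0" "- gen 1"] \<pi>.hom_inv[of "gen 1"] by (simp add: K mer)
    then have "y = mat_trace (\<rho>' (?\<pi> (gen 0 + - gen 1)))"
      using trace[of "gen 0 + - gen 1"] assms(8) by simp
    also have "\<rho>' (?\<pi> (gen 0 + - gen 1)) = mat2 m mi 0 mi * mat2 mi 0 (- (q * m)) m"
      using \<rho>'_mult[of "gen 0" "- gen 1"] \<rho>'.\<rho>_uminus[of "gen 1" m 0 "q * m" mi] nf m
      by (simp add: A_def B'_def \<rho>'_def[symmetric])
    finally have "y = 2 * (m * mi) - q * (m * mi)"
      by (simp add: mat2_arith algebra_simps)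
    then show ?thesis
      by (simp add: m)
  qed
  obtain C D where CD: "C \<in> carrier_mat 3 3" "D \<in> carrier_mat 3 3" "C * D = 1\<^sub>m 3"
    and Ad: "\<And>A. A \<in> carrier (SL 2) \<Longrightarrow> Ad_mat B A = D * adm A * C"
    by (rule Ad_mat_conjugate[OF assms(6)]) (rule that)
  have det_Phi: "det (Phi 2 rs 3 f (Ad_mat B \<circ> \<rho>) z) = det (Phi 2 rs 3 f (adm \<circ> \<rho>') z)"
    if "Poly_Mapping.keys z \<subseteq> carrier ?G" for z
  proof -
    note a3 = assoc_mult_mat[of _ 3 3 _ 3 _ 3] mult_carrier_mat[of _ 3 3]
    \<comment> \<open>These combine the change of basis of sl2 with the conjugation to normal form.
      As \<open>?V * ?U\<close> is the identity, their determinants cancel.\<close>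
    let ?U = "D * adm P" and ?V = "adm Q * C"
    have UV: "?U \<in> carrier_mat 3 3" "?V \<in> carrier_mat 3 3"
      using CD by (simp_all add: mult_carrier_mat[of _ 3 3])
    have "(Ad_mat B \<circ> \<rho>) (?\<pi> g) = ?U * (adm \<circ> \<rho>') (?\<pi> g) * ?V" if g: "g \<in> carrier ?G" for g
    proof -
      have "P * \<rho>' (?\<pi> g) * Q = P * Q * \<rho> (?\<pi> g) * (P * Q)"
        using SL(1)[OF g] PQ(1,2) unfolding \<rho>'_def by (simp add: a)
      also have "\<dots> = \<rho> (?\<pi> g)"
        using SL(1)[OF g] unfolding PQ(3) by simp
      finally have "adm (\<rho> (?\<pi> g)) = adm (P * \<rho>' (?\<pi> g) * Q)"
        by simp
      also have "\<dots> = adm P * adm (\<rho>' (?\<pi> g)) * adm Q"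
        using PQ(1,2) \<rho>'_carrier[OF g] by (simp only: adm_mult mult_carrier_mat[of _ 2 2])
      finally have "adm (\<rho> (?\<pi> g)) = adm P * adm (\<rho>' (?\<pi> g)) * adm Q" .
      moreover have "\<rho> (?\<pi> g) \<in> carrier (SL 2)"
        using SL[OF g] by (simp add: SL_def)
      ultimately show ?thesis
        using CD by (simp add: Ad a3)
    qed
    then have "Phi 2 rs 3 f (Ad_mat B \<circ> \<rho>) z = map_mat cst ?U * Phi 2 rs 3 f (adm \<circ> \<rho>') z * map_mat cst ?V"
      using UV that by (intro Phi_conjugate) simp_all
    moreover have "det (map_mat cst ?V) * det (map_mat cst ?U) = 1"
    proof -
      have "?V * ?U = adm Q * (C * D) * adm P"
        using CD(1,2) by (simp add: a3)
      also have "\<dots> = adm (Q * P)"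
        using PQ(1,2) by (simp add: CD(3) adm_mult right_mult_one_mat[of _ 3 3])
      finally have VU: "?V * ?U = 1\<^sub>m 3"
        by (simp add: PQ(4) adm_one)
      have "det (map_mat cst ?V) * det (map_mat cst ?U) = det (map_mat cst ?V * map_mat cst ?U)"
        by (rule det_mult[symmetric, of _ 3]) (use UV in simp_all)
      also have "map_mat cst ?V * map_mat cst ?U = map_mat cst (?V * ?U)"
        by (rule map_mat_cst_mult[symmetric]) (use UV in blast)+
      finally show ?thesis
        by (simp add: VU map_mat_cst_one)
    qed
    moreover have "det (map_mat cst ?U * Phi 2 rs 3 f (adm \<circ> \<rho>') z * map_mat cst ?V) =
        det (map_mat cst ?V) * det (map_mat cst ?U) * det (Phi 2 rs 3 f (adm \<circ> \<rho>') z)"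
      using UV by (simp add: det_mult[of _ 3] mult_carrier_mat[of _ 3 3])
    ultimately show ?thesis
      by simp
  qed
  have keys: "Poly_Mapping.keys (1 - elt (gen j)) \<subseteq> carrier ?G" if "j < 2" for j
    using keys_diff[of 1 "elt (gen j)"] that by auto
  have \<rho>'_rel: "\<rho>' (?\<pi> ?r) = 1\<^sub>m 2"
    using PQ by (simp add: \<rho>'_def \<rho>_rel)
  have nf': "\<rho>' (?\<pi> (gen 0)) = mat2 m mi 0 mi" "\<rho>' (?\<pi> (gen 1)) = mat2 m 0 (q * m) mi"
    using nf by (simp_all add: \<rho>'_def A_def B'_def)
  note main = riley_twisted_alexander[where f = f and \<rho> = \<rho>' and n = n and x = x and y = y, folded rs_def,
      OF f_add \<rho>'_mult \<rho>'_carrier \<rho>'.\<rho>_zero f_rel \<rho>'_rel f_a f_b nf' m x y assms(1,9,10)]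
  \<comment> \<open>The unit is t^-3 in both cases, inherited from the factor \<open>ti ^ 3\<close>
    of \<open>riley_det\<close>, so the exponent in \<open>eq_upto_unit\<close> is -1.\<close>
  have "twist_alexander n 3 f (Ad_mat B \<circ> \<rho>) 0 = tvar powi (int 3 * - 1) * R"
    using main(2) keys[of 0] keys_fox[OF twist_relator_in] unfolding twist_alexander_eq rs_def[symmetric] by (simp add: det_Phi)
  moreover have "twist_alexander n 3 f (Ad_mat B \<circ> \<rho>) 1 = tvar powi (int 3 * - 1) * - R"
    using main(3) keys[of 1] keys_fox[OF twist_relator_in] unfolding twist_alexander_eq rs_def[symmetric] by (simp add: det_Phi)
  moreover have "mat_trace (\<rho> (mer_b n)) = x"
    using tr assms(7) by (simp add: mer A_def B'_def)
  ultimately show ?thesis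
    using main(1) unfolding eq_upto_unit_def by (intro conjI exI[of _ "- 1"])
qed

end
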